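(* MaxCut on split graphs with $n$ vertices can be solved in time $O(2^{n/2}\cdot\mathrm{poly}) = O^{*}(1.42^{n})$.
   Context: All graphs are finite and simple. A split graph is a graph whose vertex set can be partitioned into a clique and an independent set. A cut of a graph $G=(V,E)$ is a partition $(V_1,V_2)$ of $V$; its size is the number of edges with one endpoint in $V_1$ and the other in $V_2$. MaxCut: given a graph $G$, find a cut of maximum size. "poly" denotes a factor polynomial in $n$, and $O^{*}(c^n)$ denotes $O(c^n\cdot\mathrm{poly}(n))$. *)

theory Defs
  imports Complex_Main "HOL-Library.Landau_Symbols" "HOL-Library.Log_Nat"
    "HOL-Computational_Algebra.Polynomial"
begin

section \<open>Graphs and cuts\<close>

definition simple_graph :: "'a set \<Rightarrow> 'a set set \<Rightarrow> bool" where
  "simple_graph V E \<longleftrightarrow> finite V \<and> (\<forall>e\<in>E. e \<subseteq> V \<and> card e = 2)"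

definition clique :: "'a set set \<Rightarrow> 'a set \<Rightarrow> bool" where
  "clique E K \<longleftrightarrow> (\<forall>u\<in>K. \<forall>v\<in>K. u \<noteq> v \<longrightarrow> {u, v} \<in> E)"

definition independent_set :: "'a set set \<Rightarrow> 'a set \<Rightarrow> bool" where
  "independent_set E I \<longleftrightarrow> (\<forall>u\<in>I. \<forall>v\<in>I. u \<noteq> v \<longrightarrow> {u, v} \<notin> E)"

definition split_graph :: "'a set \<Rightarrow> 'a set set \<Rightarrow> bool" where
  "split_graph V E \<longleftrightarrow> simple_graph V E \<and>
     (\<exists>K I. K \<union> I = V \<and> K \<inter> I = {} \<and> clique E K \<and> independent_set E I)"

text \<open>As usual for maximum cut problems, one side of a cut may be empty.\<close>

definition is_cut :: "'a set \<Rightarrow> 'a set \<Rightarrow> 'a set \<Rightarrow> bool" where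
  "is_cut V V1 V2 \<longleftrightarrow> V1 \<union> V2 = V \<and> V1 \<inter> V2 = {}"

definition cut_size :: "'a set set \<Rightarrow> 'a set \<Rightarrow> 'a set \<Rightarrow> nat" where
  "cut_size E V1 V2 = card {e\<in>E. \<exists>u\<in>V1. \<exists>v\<in>V2. e = {u, v}}"

definition is_max_cut :: "'a set \<Rightarrow> 'a set set \<Rightarrow> 'a set \<Rightarrow> 'a set \<Rightarrow> bool" where
  "is_max_cut V E V1 V2 \<longleftrightarrow> is_cut V V1 V2 \<and>
     (\<forall>W1 W2. is_cut V W1 W2 \<longrightarrow> cut_size E W1 W2 \<le> cut_size E V1 V2)"

section \<open>A random access machine with logarithmic cost\<close>

text \<open>
  Programs operate on natural numbers kept in registers and in an indirectly addressable
  memory (first and second component of a state). Time is measured by the logarithmic cost criterion of Aho, Hopcroft and Ullman: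
  every value that is read, computed, or used as an address is charged its bit length,
  so operations on long numbers are not free.
\<close>

type_synonym state = "(nat \<Rightarrow> nat) \<times> (nat \<Rightarrow> nat)"

datatype expr =
    Const nat
  | Reg nat
  | Load expr
  | Plus expr expr
  | Minus expr expr
  | Times expr expr

datatype com =
    Skip
  | Assign nat expr
  | Store expr expr
  | Seq com com
  | If expr com com
  | While expr com

text \<open>\<^const>\<open>Minus\<close> is truncated subtraction.\<close>

fun val :: "state \<Rightarrow> expr \<Rightarrow> nat" where
  "val s (Const k) = k"
| "val s (Reg x) = fst s x"
| "val s (Load a) = snd s (val s a)"
| "val s (Plus a b) = val s a + val s b"
| "val s (Minus a b) = val s a - val s b"
| "val s (Times a b) = val s a * val s b"

text \<open>The bit length of a number, with zero counted as having length one.\<close>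

definition len :: "nat \<Rightarrow> nat" where
  "len k = max 1 (floorlog 2 k)"

fun cost :: "state \<Rightarrow> expr \<Rightarrow> nat" where
  "cost s (Const k) = len k"
| "cost s (Reg x) = len (fst s x)"
| "cost s (Load a) = cost s a + len (val s (Load a))"
| "cost s (Plus a b) = cost s a + cost s b + len (val s (Plus a b))"
| "cost s (Minus a b) = cost s a + cost s b + len (val s (Minus a b))"
| "cost s (Times a b) = cost s a + cost s b + len (val s (Times a b))"

text \<open>
  \<open>exec c s t s'\<close>: started in state \<open>s\<close>, the program \<open>c\<close> terminates in state \<open>s'\<close> after
  time \<open>t\<close>. A condition holds iff its value is nonzero.
\<close>

inductive exec :: "com \<Rightarrow> state \<Rightarrow> nat \<Rightarrow> state \<Rightarrow> bool" where
  Skip: "exec Skip s 1 s"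
| Assign: "exec (Assign x a) s (1 + cost s a) ((fst s)(x := val s a), snd s)"
| Store: "exec (Store a b) s (1 + cost s a + cost s b) (fst s, (snd s)(val s a := val s b))"
| Seq: "exec c1 s1 t1 s2 \<Longrightarrow> exec c2 s2 t2 s3 \<Longrightarrow> exec (Seq c1 c2) s1 (t1 + t2) s3"
| IfTrue: "val s b \<noteq> 0 \<Longrightarrow> exec c1 s t s' \<Longrightarrow> exec (If b c1 c2) s (1 + cost s b + t) s'"
| IfFalse: "val s b = 0 \<Longrightarrow> exec c2 s t s' \<Longrightarrow> exec (If b c1 c2) s (1 + cost s b + t) s'"
| WhileFalse: "val s b = 0 \<Longrightarrow> exec (While b c) s (1 + cost s b) s"
| WhileTrue: "val s1 b \<noteq> 0 \<Longrightarrow> exec c s1 t1 s2 \<Longrightarrow> exec (While b c) s2 t2 s3 \<Longrightarrow>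
    exec (While b c) s1 (1 + cost s1 b + t1 + t2) s3"

inductive_cases exec_SkipE: "exec Skip s t s'"
inductive_cases exec_AssignE: "exec (Assign x a) s t s'"
inductive_cases exec_StoreE: "exec (Store a b) s t s'"
inductive_cases exec_SeqE: "exec (Seq c1 c2) s t s'"
inductive_cases exec_IfE: "exec (If b c1 c2) s t s'"
inductive_cases exec_WhileE: "exec (While b c) s t s'"

lemma exec_deterministic:
  "exec c s t s' \<Longrightarrow> exec c s t' s'' \<Longrightarrow> t' = t \<and> s'' = s'"
proof (induction arbitrary: t' s'' rule: exec.induct)
  case (Skip s)
  then show ?case by (rule exec_SkipE) simp
next
  case (Assign x a s)
  then show ?case by (rule exec_AssignE) simp
next
  case (Store a b s)
  then show ?case by (rule exec_StoreE) simp
next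
  case (Seq c1 s1 t1 s2 c2 t2 s3)
  from Seq.prems show ?case
  proof (rule exec_SeqE)
    fix u1 r u2
    assume t': "t' = u1 + u2" and r: "exec c1 s1 u1 r" "exec c2 r u2 s''"
    from Seq.IH(1)[OF r(1)] have "u1 = t1" "r = s2" by simp_all
    with Seq.IH(2)[of u2 s''] r(2) t' show ?thesis by simp
  qed
next
  case (IfTrue s b c1 t s' c2)
  from IfTrue.prems show ?case
    by (rule exec_IfE) (use IfTrue.hyps in \<open>auto dest: IfTrue.IH\<close>)
next
  case (IfFalse s b c2 t s' c1)
  from IfFalse.prems show ?case
    by (rule exec_IfE) (use IfFalse.hyps in \<open>auto dest: IfFalse.IH\<close>)
next
  case (WhileFalse s b c)
  from WhileFalse.prems show ?case
    by (rule exec_WhileE) (use WhileFalse.hyps in auto)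
next
  case (WhileTrue s1 b c t1 s2 t2 s3)
  from WhileTrue.prems show ?case
  proof (rule exec_WhileE)
    assume "val s1 b = 0"
    with WhileTrue.hyps show ?thesis by simp
  next
    fix u1 r u2
    assume t': "t' = Suc (cost s1 b + u1 + u2)"
      and r: "exec c s1 u1 r" "exec (While b c) r u2 s''"
    from WhileTrue.IH(1)[OF r(1)] have "u1 = t1" "r = s2" by simp_all
    with WhileTrue.IH(2)[of u2 s''] r(2) t' show ?thesis by simp
  qed
qed

section \<open>Solving MaxCut\<close>

text \<open>
  A graph with vertex set \<open>{..<n}\<close> is presented to a program by its number of vertices, in
  register 0, and its adjacency matrix, stored row by row in the memory cells below \<open>n * n\<close>;
  everything else is zero. A partition into clique and independent set is not part of the
  input. The cut found by the program is read off the first \<open>n\<close> memory cells of the final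
  state.
\<close>

definition encode_graph :: "nat \<Rightarrow> nat set set \<Rightarrow> state" where
  "encode_graph n E =
     ((\<lambda>_. 0)(0 := n),
      \<lambda>i. if i < n * n \<and> {i div n, i mod n} \<in> E then 1 else 0)"

definition decode_cut :: "nat \<Rightarrow> state \<Rightarrow> nat set" where
  "decode_cut n s = {v. v < n \<and> snd s v \<noteq> 0}"

definition solves_maxcut_on ::
  "(nat set \<Rightarrow> nat set set \<Rightarrow> bool) \<Rightarrow> com \<Rightarrow> (nat \<Rightarrow> nat) \<Rightarrow> bool" where
  "solves_maxcut_on \<G> c T \<longleftrightarrow>
     (\<forall>n E. \<G> {..<n} E \<longrightarrow>
        (\<exists>t s. exec c (encode_graph n E) t s \<and> t \<le> T n \<and>
           is_max_cut {..<n} E (decode_cut n s) ({..<n} - decode_cut n s)))"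

text \<open>\<open>O_star f\<close> is the class \<open>O(f(n) \<cdot> poly(n))\<close>.\<close>

definition O_star :: "(nat \<Rightarrow> real) \<Rightarrow> (nat \<Rightarrow> real) set" where
  "O_star f = (\<Union>p :: real poly. O(\<lambda>n. f n * poly p (real n)))"

end

theory Submission imports Defs begin

text \<open>
  Let \<open>S\<close> be the smaller part of a partition into a clique and an independent set, so
  \<open>card S \<le> n div 2\<close>, and let \<open>R\<close> be the other part. All \<open>2 ^ card S\<close> cuts of \<open>S\<close> are tried. Once
  \<open>S\<close> is cut, the best way to put exactly \<open>k\<close> vertices of \<open>R\<close> on the first side is to take the \<open>k\<close>
  vertices of largest gain, because the number of cut edges inside \<open>R\<close> depends on \<open>k\<close> only; ties are
  broken by the vertex number, so this set is given by a threshold. By an exchange argument, the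
  vertices whose degree (with ties broken in the same way) exceeds a suitable threshold also form
  the clique of a split partition. The program does not recognise the right thresholds: it runs
  through all of them, evaluates every resulting cut, and keeps the best one.
\<close>

section \<open>Running time on the random access machine\<close>

text \<open>A wrong guess is harmless: every choice of parameters yields a genuine cut, so it is
  enough that the recorded value belongs to the stored cut and that one choice is good. A choice
  consists of a mask \<open>m\<close> for the cut of S, an interval \<open>p\<close>,
  \<open>q\<close> of degree keys that describes S, and a gain threshold. An interval is used
  because S may be either side of the split partition, the clique being an upper set of keys and the
  independent set a lower one. Only the mask ranges over exponentially many values, 2 ^ (n div 2);
  each threshold has O(n^2) values. The exponent 9 in the time bound is 6 + 2 + 1: three thresholds,
  O(n^2) elementary steps per candidate, and O(n) for each step, because every stored number has at
  most 2 * n + 4 bits. The machine has neither division nor comparison, and its subtraction is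
  truncated. Hence tests are differences or products of differences, masks are read from the top
  digit by doubling, and gains are shifted by n to become natural numbers.\<close>

lemma len_le: "k < 2 ^ l \<Longrightarrow> 1 \<le> l \<Longrightarrow> len k \<le> l"
  by (simp add: len_def floorlog_leI)

lemma less_two_power_len: "k < 2 ^ len k"
proof (cases "k = 0")
  case False
  have "k < 2 ^ floorlog 2 k" using floorlog_bounds[of k 2] False by simp
  also have "\<dots> \<le> 2 ^ len k" by (rule power_increasing) (auto simp: len_def)
  finally show ?thesis .
qed simp

lemma len_pos: "1 \<le> len k"
  by (simp add: len_def)

lemma len_mono: "j \<le> k \<Longrightarrow> len j \<le> len k"
  using less_two_power_len[of k] by (intro len_le len_pos) simp

lemma len_add: "len (j + k) \<le> len j + len k"
proof (rule len_le)
  have "j + k < 2 ^ len j + 2 ^ len k"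
    using less_two_power_len[of j] less_two_power_len[of k] by simp
  also have "\<dots> \<le> 2 ^ len j * 2 ^ len k"
  proof -
    \<comment> \<open>\<open>len\<close> is never 0, so both powers are at least 2, and the sum of
      two such numbers is at most their product.\<close>
    have "(2::nat) \<le> 2 ^ len j" "(2::nat) \<le> 2 ^ len k"
      using power_increasing[OF len_pos, of "2::nat"] by simp_all
    then obtain p q where "(2::nat) ^ len j = 2 + p" "(2::nat) ^ len k = 2 + q"
      using le_Suc_ex by metis
    then show ?thesis by (simp add: algebra_simps)
  qed
  finally show "j + k < 2 ^ (len j + len k)" by (simp add: power_add)
qed (use len_pos[of j] in simp)

lemma len_mult: "len (j * k) \<le> len j + len k"
proof (rule len_le)
  show "j * k < 2 ^ (len j + len k)"
    unfolding power_add by (rule mult_strict_mono) (auto simp: less_two_power_len)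
qed (use len_pos[of j] in simp)

lemma len_le_Suc: "len k \<le> k + 1"
proof (rule len_le)
  have "k < 2 ^ k" by (rule less_exp)
  also have "\<dots> \<le> 2 ^ (k + 1)" by simp
  finally show "k < 2 ^ (k + 1)" .
qed simp

section \<open>Cost of an expression in terms of its size and the word length\<close>

definition bounded_state :: "nat \<Rightarrow> state \<Rightarrow> bool" where
  "bounded_state l s \<longleftrightarrow> (\<forall>x. fst s x < 2 ^ l) \<and> (\<forall>i. snd s i < 2 ^ l)"

text \<open>A constant counts with its value, so that the size alone, times the word length, bounds
  the bit length of every value.\<close>

fun expr_size :: "expr \<Rightarrow> nat" where
  "expr_size (Const k) = k + 1"
| "expr_size (Reg x) = 1"
| "expr_size (Load a) = expr_size a + 1"
| "expr_size (Plus a b) = expr_size a + expr_size b + 1"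
| "expr_size (Minus a b) = expr_size a + expr_size b + 1"
| "expr_size (Times a b) = expr_size a + expr_size b + 1"

lemma len_val_le:
  assumes "bounded_state l s" "1 \<le> l"
  shows "len (val s e) \<le> expr_size e * l"
proof (induction e)
  case (Const k)
  have "len k \<le> k + 1" by (rule len_le_Suc)
  also have "\<dots> \<le> (k + 1) * l" using assms(2) by (metis mult_le_mono2 mult.right_neutral)
  finally show ?case by simp
next
  case (Reg x)
  show ?case using assms by (simp add: bounded_state_def len_le)
next
  case (Load a)
  have "len (snd s (val s a)) \<le> l" using assms by (simp add: bounded_state_def len_le)
  then show ?case by simp
next
  case (Plus a b)
  then show ?case using len_add[of "val s a" "val s b"] by (simp add: algebra_simps)
next
  case (Minus a b)
  then show ?case using len_mono[of "val s a - val s b" "val s a"] by (simp add: algebra_simps)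
next
  case (Times a b)
  then show ?case using len_mult[of "val s a" "val s b"] by (simp add: algebra_simps)
qed

text \<open>Each node is charged a bit length of at most size times \<open>l\<close>, and there are
  at most size many nodes; hence the square.\<close>

lemma cost_le:
  assumes "bounded_state l s" "1 \<le> l"
  shows "cost s e \<le> (expr_size e)\<^sup>2 * l"
proof -
  have two: "c \<le> (p + q + 1)\<^sup>2 * l"
    if "c \<le> p\<^sup>2 * l + q\<^sup>2 * l + (p + q + 1) * l" for c p q
  proof -
    have "p\<^sup>2 + q\<^sup>2 + (p + q + 1) \<le> (p + q + 1)\<^sup>2" by (simp add: power2_eq_square algebra_simps)
    then have "(p\<^sup>2 + q\<^sup>2 + (p + q + 1)) * l \<le> (p + q + 1)\<^sup>2 * l" by (rule mult_le_mono1)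
    with that show ?thesis by (simp add: distrib_right)
  qed
  show ?thesis
  proof (induction e)
    case (Const k)
    have "len (val s (Const k)) \<le> (k + 1) * l" using len_val_le[OF assms, of "Const k"] by simp
    also have "\<dots> \<le> (k + 1)\<^sup>2 * l" by (simp add: power2_eq_square)
    finally show ?case by simp
  next
    case (Reg x)
    show ?case using len_val_le[OF assms, of "Reg x"] by simp
  next
    case (Load a)
    then show ?case using len_val_le[OF assms, of "Load a"]
      two[of "cost s (Load a)" "expr_size a" 0] by simp
  next
    case (Plus a b)
    then show ?case using len_val_le[OF assms, of "Plus a b"]
      two[of "cost s (Plus a b)" "expr_size a" "expr_size b"] by simp
  next
    case (Minus a b)
    then show ?case using len_val_le[OF assms, of "Minus a b"]
      two[of "cost s (Minus a b)" "expr_size a" "expr_size b"] by simp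
  next
    case (Times a b)
    then show ?case using len_val_le[OF assms, of "Times a b"]
      two[of "cost s (Times a b)" "expr_size a" "expr_size b"] by simp
  qed
qed

section \<open>Total correctness with a time budget: Hoare-style rules\<close>

definition runs :: "com \<Rightarrow> state \<Rightarrow> nat \<Rightarrow> (state \<Rightarrow> bool) \<Rightarrow> bool" where
  "runs c s T Q \<longleftrightarrow> (\<exists>t s'. exec c s t s' \<and> t \<le> T \<and> Q s')"

lemma runs_weaken:
  "runs c s T Q \<Longrightarrow> T \<le> T' \<Longrightarrow> (\<And>s'. Q s' \<Longrightarrow> Q' s') \<Longrightarrow> runs c s T' Q'"
  unfolding runs_def by (meson order_trans)

lemma runs_Seq:
  assumes "runs c1 s T1 R" "\<And>s'. R s' \<Longrightarrow> runs c2 s' T2 Q" "T1 + T2 \<le> T"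
  shows "runs (Seq c1 c2) s T Q"
proof -
  obtain t1 s1 where 1: "exec c1 s t1 s1" "t1 \<le> T1" "R s1" using assms(1) by (auto simp: runs_def)
  obtain t2 s2 where 2: "exec c2 s1 t2 s2" "t2 \<le> T2" "Q s2"
    using assms(2)[OF 1(3)] by (auto simp: runs_def)
  have "exec (Seq c1 c2) s (t1 + t2) s2" using 1 2 by (blast intro: exec.Seq)
  moreover have "t1 + t2 \<le> T" using 1 2 assms(3) by simp
  ultimately show ?thesis using 2 unfolding runs_def by blast
qed

text \<open>Subtraction being truncated, the guard is nonzero exactly while \<open>x\<close> is
  below \<open>e\<close>. The bound \<open>e\<close> is evaluated again in every round.\<close>

definition For :: "nat \<Rightarrow> expr \<Rightarrow> com \<Rightarrow> com" where
  "For x e c = Seq (Assign x (Const 0))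
     (While (Minus e (Reg x)) (Seq c (Assign x (Plus (Reg x) (Const 1)))))"

definition Sum :: "nat \<Rightarrow> nat \<Rightarrow> expr \<Rightarrow> com" where
  "Sum r x e = Seq (Assign r (Const 0)) (For x (Reg 0) (Assign r (Plus (Reg r) e)))"

text \<open>The bound on expression sizes is an arbitrary number large enough for the program below.\<close>

locale bounded_ram =
  fixes l :: nat
  assumes l_pos: "1 \<le> l"
begin

text \<open>The dearest elementary step is a \<open>Store\<close>: 1 plus the costs of two
  expressions of size at most 50, each at most 50^2 * \<open>l\<close>; the 1 is absorbed by
  \<open>1 \<le> l\<close>.\<close>

definition unit_cost :: nat where "unit_cost = 5001 * l"

lemma cost_le_unit:
  assumes "bounded_state l s" "expr_size e \<le> 50"
  shows "cost s e \<le> 2500 * l"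
proof -
  have "cost s e \<le> (expr_size e)\<^sup>2 * l" by (rule cost_le[OF assms(1) l_pos])
  also have "\<dots> \<le> 50\<^sup>2 * l" using assms(2) by (intro mult_le_mono1 power_mono) auto
  finally show ?thesis by simp
qed

lemma bounded_state_reg:
  "bounded_state l s \<Longrightarrow> k < 2 ^ l \<Longrightarrow> bounded_state l ((fst s)(x := k), snd s)"
  by (simp add: bounded_state_def)

lemma bounded_state_mem:
  "bounded_state l s \<Longrightarrow> k < 2 ^ l \<Longrightarrow> bounded_state l (fst s, (snd s)(i := k))"
  by (simp add: bounded_state_def)

lemma runs_Assign:
  assumes "bounded_state l s" "expr_size e \<le> 50" "Q ((fst s)(x := val s e), snd s)"
  shows "runs (Assign x e) s unit_cost Q"
  unfolding runs_def
  using exec.Assign[of x e s] cost_le_unit[OF assms(1,2)] assms(3) l_pos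
  by (intro exI[of _ "1 + cost s e"] exI[of _ "((fst s)(x := val s e), snd s)"])
    (simp add: unit_cost_def)

lemma runs_Store:
  assumes "bounded_state l s" "expr_size a \<le> 50" "expr_size e \<le> 50"
    "Q (fst s, (snd s)(val s a := val s e))"
  shows "runs (Store a e) s unit_cost Q"
  unfolding runs_def
  using exec.Store[of a e s] cost_le_unit[OF assms(1,2)] cost_le_unit[OF assms(1,3)] assms(4) l_pos
  by (intro exI[of _ "1 + cost s a + cost s e"] exI[of _ "(fst s, (snd s)(val s a := val s e))"])
    (simp add: unit_cost_def)

lemma runs_If:
  assumes "bounded_state l s" "expr_size e \<le> 50"
    "val s e \<noteq> 0 \<Longrightarrow> runs c1 s T Q" "val s e = 0 \<Longrightarrow> runs c2 s T Q"
  shows "runs (If e c1 c2) s (unit_cost + T) Q"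
proof -
  have u: "1 + cost s e \<le> unit_cost"
    using cost_le_unit[OF assms(1,2)] l_pos by (simp add: unit_cost_def)
  show ?thesis
  proof (cases "val s e = 0")
    case True
    then obtain t s' where "exec c2 s t s'" "t \<le> T" "Q s'" using assms(4) by (auto simp: runs_def)
    with True u exec.IfFalse[of s e c2 t s' c1] show ?thesis unfolding runs_def
      by (intro exI[of _ "1 + cost s e + t"] exI[of _ s']) simp
  next
    case False
    then obtain t s' where "exec c1 s t s'" "t \<le> T" "Q s'" using assms(3) by (auto simp: runs_def)
    with False u exec.IfTrue[of s e c1 t s' c2] show ?thesis unfolding runs_def
      by (intro exI[of _ "1 + cost s e + t"] exI[of _ s']) simp
  qed
qed

text \<open>\<open>P i\<close> describes the state just before the test in round \<open>i\<close>,
  so the body has to establish \<open>P (Suc i)\<close> for the state after the increment. A round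
  pays for the body, the test and the increment. The bound 48 leaves room for the two nodes that the
  guard adds to \<open>e\<close>.\<close>

lemma runs_For:
  assumes inv: "\<And>i s. P i s \<Longrightarrow> fst s x = i \<and> val s e = N \<and> bounded_state l s"
    and size: "expr_size e \<le> 48"
    and init: "bounded_state l s" "P 0 ((fst s)(x := 0), snd s)"
    and body: "\<And>i s. i < N \<Longrightarrow> P i s \<Longrightarrow> runs c s T (\<lambda>s'. fst s' x = i \<and> bounded_state l s' \<and>
      P (Suc i) ((fst s')(x := Suc i), snd s'))"
  shows "runs (For x e c) s ((N + 1) * (T + 3 * unit_cost)) (P N)"
proof -
  let ?w = "While (Minus e (Reg x)) (Seq c (Assign x (Plus (Reg x) (Const 1))))"
  have u: "1 + cost s (Minus e (Reg x)) \<le> unit_cost" if "bounded_state l s" for s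
    using cost_le_unit[OF that, of "Minus e (Reg x)"] size l_pos by (simp add: unit_cost_def)
  have loop: "runs ?w s (k * (T + 2 * unit_cost) + unit_cost) (P N)" if "P i s" "i + k = N" for k i s
    using that
  proof (induction k arbitrary: i s)
    case 0
    with inv[OF 0(1)] have "val s (Minus e (Reg x)) = 0" by simp
    from exec.WhileFalse[OF this] show ?case
      unfolding runs_def using u[of s] inv[OF 0(1)] 0
      by (intro exI[of _ "1 + cost s (Minus e (Reg x))"] exI[of _ s]) auto
  next
    case (Suc k)
    have nz: "val s (Minus e (Reg x)) \<noteq> 0" using inv[OF Suc.prems(1)] Suc.prems(2) by simp
    have "runs (Seq c (Assign x (Plus (Reg x) (Const 1)))) s (T + unit_cost) (P (Suc i))"
      by (rule runs_Seq[OF body[of i s]])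
        (use Suc.prems in \<open>auto intro!: runs_Assign\<close>)
    then obtain t1 s1 where 1: "exec (Seq c (Assign x (Plus (Reg x) (Const 1)))) s t1 s1"
      "t1 \<le> T + unit_cost" "P (Suc i) s1" by (auto simp: runs_def)
    from Suc.IH[OF 1(3)] Suc.prems(2) obtain t2 s2 where
      2: "exec ?w s1 t2 s2" "t2 \<le> k * (T + 2 * unit_cost) + unit_cost" "P N s2"
      by (auto simp: runs_def)
    from exec.WhileTrue[OF nz 1(1) 2(1)] show ?case
      unfolding runs_def using u[of s] inv[OF Suc.prems(1)] 1(2) 2(2,3)
      by (intro exI[of _ "1 + cost s (Minus e (Reg x)) + t1 + t2"] exI[of _ s2]) simp
  qed
  show ?thesis unfolding For_def
  proof (rule runs_Seq)
    show "runs (Assign x (Const 0)) s unit_cost (P 0)"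
      by (rule runs_Assign) (use init in auto)
    show "runs ?w s' (N * (T + 2 * unit_cost) + unit_cost) (P N)" if "P 0 s'" for s'
      using loop[OF that, of N] by simp
  qed (simp add: algebra_simps)
qed

lemma runs_Sum:
  assumes "bounded_state l s" "fst s 0 < 2 ^ l" "expr_size e \<le> 48" "r \<noteq> x" "r \<noteq> 0" "x \<noteq> 0"
    and val: "\<And>u k. u < fst s 0 \<Longrightarrow> val ((fst s)(x := u, r := k), snd s) e = f u"
    and "(\<Sum>u<fst s 0. f u) < 2 ^ l"
  shows "runs (Sum r x e) s (5 * unit_cost * (fst s 0 + 1))
    (\<lambda>s'. s' = ((fst s)(x := fst s 0, r := \<Sum>u<fst s 0. f u), snd s))"
proof -
  let ?n = "fst s 0"
  let ?P = "\<lambda>i s'. i \<le> ?n \<and> s' = ((fst s)(x := i, r := \<Sum>u<i. f u), snd s)"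
  have mono: "(\<Sum>u<i. f u) < 2 ^ l" if "i \<le> ?n" for i
  proof -
    have "(\<Sum>u<i. f u) \<le> (\<Sum>u<?n. f u)" using that by (intro sum_mono2) auto
    with assms(8) show ?thesis by simp
  qed
  have bounded: "bounded_state l ((fst s)(x := i, r := \<Sum>u<j. f u), snd s)"
    if "i \<le> ?n" "j \<le> ?n" for i j
    using assms(1) mono[OF that(2)] le_less_trans[OF that(1) assms(2)] by (auto simp: bounded_state_def)
  show ?thesis unfolding Sum_def
  proof (rule runs_Seq)
    show "runs (Assign r (Const 0)) s unit_cost (\<lambda>s'. s' = ((fst s)(r := 0), snd s))"
      by (rule runs_Assign) (use assms in auto)
    show "runs (For x (Reg 0) (Assign r (Plus (Reg r) e))) s'
      ((?n + 1) * (unit_cost + 3 * unit_cost))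
      (\<lambda>s'. s' = ((fst s)(x := ?n, r := \<Sum>u<?n. f u), snd s))"
      if s': "s' = ((fst s)(r := 0), snd s)" for s'
    proof (rule runs_weaken[OF runs_For[where P = ?P and N = ?n]])
      show "fst t x = i \<and> val t (Reg 0) = ?n \<and> bounded_state l t" if "?P i t" for i t
        using that assms bounded[of i i] by auto
      show "bounded_state l s'" using assms(1) s' by (simp add: bounded_state_def)
      show "?P 0 ((fst s')(x := 0), snd s')" using s' assms(4) by (auto simp: fun_eq_iff)
      show "runs (Assign r (Plus (Reg r) e)) t unit_cost (\<lambda>s'. fst s' x = i \<and>
        bounded_state l s' \<and> ?P (Suc i) ((fst s')(x := Suc i), snd s'))"
        if "i < ?n" "?P i t" for i t
      proof (rule runs_Assign)
        have v: "val t (Plus (Reg r) e) = (\<Sum>u<Suc i. f u)"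
          using that val[of i "\<Sum>u<i. f u"] by simp
        show "bounded_state l t" using that bounded[of i i] by simp
        show "expr_size (Plus (Reg r) e) \<le> 50" using assms by simp
        show "fst ((fst t)(r := val t (Plus (Reg r) e)), snd t) x = i \<and>
         bounded_state l ((fst t)(r := val t (Plus (Reg r) e)), snd t) \<and>
         ?P (Suc i) ((fst ((fst t)(r := val t (Plus (Reg r) e)), snd t))(x := Suc i),
            snd ((fst t)(r := val t (Plus (Reg r) e)), snd t))"
          unfolding v using that bounded[of i "Suc i"] assms(4) by (auto simp: fun_upd_twist)
      qed
    qed (use assms in auto)
  qed (simp add: algebra_simps)
qed

end

section \<open>Maximum cuts of split graphs\<close>

text \<open>A member of \<open>F\<close> with the greatest key sum admits no improvement, so by
  \<open>exch\<close> no outside element has a larger key than an inside one. Injectivity excludes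
  ties, which makes the set an upper set of the key order with its least key as threshold. Both
  threshold arguments below are instances.\<close>

lemma threshold_exchange:
  fixes key :: "'a \<Rightarrow> nat"
  assumes "finite U" "F \<noteq> {}" "\<And>T. T \<in> F \<Longrightarrow> T \<subseteq> U" "inj_on key U"
    and bound: "\<And>v. v \<in> U \<Longrightarrow> key v < b"
    and exch: "\<And>T u v. \<lbrakk>T \<in> F; v \<in> T; u \<in> U - T; key v < key u\<rbrakk> \<Longrightarrow> \<exists>T'\<in>F. sum key T < sum key T'"
  shows "\<exists>T\<in>F. \<exists>\<theta>\<le>b. T = {v\<in>U. \<theta> \<le> key v}"
proof -
  have "finite F" using assms(1,3) by (meson Pow_iff finite_Pow_iff finite_subset subsetI)
  then obtain T where T: "T \<in> F" "\<And>T'. T' \<in> F \<Longrightarrow> sum key T' \<le> sum key T"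
    using obtains_MAX[of F "sum key"] assms(2) Max_ge[of "sum key ` F"] by (metis finite_imageI imageI)
  have fin: "finite T" using T assms(1,3) finite_subset by blast
  have up: "key u < key v" if "v \<in> T" "u \<in> U - T" for u v
  proof -
    have "\<not> key v < key u" using exch[OF T(1) that] T(2) by (meson leD)
    moreover have "key u \<noteq> key v" using that T(1) assms(3,4) by (metis DiffD1 DiffD2 inj_onD subsetD)
    ultimately show ?thesis by simp
  qed
  show ?thesis
  proof (cases "T = {}")
    case True
    \<comment> \<open>All keys lie below \<open>b\<close>, so the threshold \<open>b\<close> selects
      nothing.\<close>
    with T(1) bound show ?thesis by (intro bexI[of _ T] exI[of _ b]) (auto simp: not_le)
  next
    case False
    then have "Min (key ` T) \<in> key ` T" using fin by simp
    then obtain v where v: "v \<in> T" "key v = Min (key ` T)" by auto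
    have "T = {u\<in>U. key v \<le> key u}"
    proof safe
      fix u assume "u \<in> T" then show "u \<in> U" using T(1) assms(3) by blast
    next
      fix u assume "u \<in> T" then show "key v \<le> key u" using v fin by simp
    next
      fix u assume "u \<in> U" "key v \<le> key u"
      then show "u \<in> T" using up[OF v(1), of u] by fastforce
    qed
    moreover have "key v \<le> b" using v(1) T(1) assms(3) bound by (meson less_imp_le subsetD)
    ultimately show ?thesis using T(1) by blast
  qed
qed

locale adjacency =
  fixes n :: nat and a :: "nat \<Rightarrow> nat \<Rightarrow> nat"
  assumes a_le: "a u v \<le> 1" and a_sym: "u < n \<Longrightarrow> v < n \<Longrightarrow> a u v = a v u"
    and a_irrefl: "v < n \<Longrightarrow> a v v = 0"
begin

definition deg :: "nat \<Rightarrow> nat" where "deg v = (\<Sum>u<n. a v u)"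

text \<open>For a 0/1 vector this counts every cut edge once, directed from the side with value 1 to
  the side with value 0.\<close>

definition cut_value :: "(nat \<Rightarrow> nat) \<Rightarrow> nat" where
  "cut_value x = (\<Sum>u<n. x u * (\<Sum>v<n. a u v * (1 - x v)))"

lemma deg_eq_card: "deg v = card {u. u < n \<and> a v u \<noteq> 0}"
proof -
  have "deg v = (\<Sum>u<n. if a v u \<noteq> 0 then 1 else 0)"
    unfolding deg_def
  proof (intro sum.cong refl)
    show "a v u = (if a v u \<noteq> 0 then 1 else 0)" for u using a_le[of v u] by auto
  qed
  also have "\<dots> = card {u. u < n \<and> a v u \<noteq> 0}"
    by (simp add: sum.If_cases Int_def)
  finally show ?thesis .
qed

lemma deg_le: "deg v \<le> n"
  unfolding deg_def using sum_bounded_above[of "{..<n}" "a v" 1] a_le by simp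

section \<open>Split partitions given by a degree threshold\<close>

definition split_part :: "nat set \<Rightarrow> bool" where
  "split_part K \<longleftrightarrow> K \<subseteq> {..<n} \<and> (\<forall>u\<in>K. \<forall>v\<in>K. u \<noteq> v \<longrightarrow> a u v = 1) \<and>
     (\<forall>u\<in>{..<n} - K. \<forall>v\<in>{..<n} - K. u \<noteq> v \<longrightarrow> a u v = 0)"

text \<open>For \<open>v < n\<close> these numbers order the vertices lexicographically by
  \<open>f v\<close> and then \<open>v\<close>; the remainder modulo \<open>n\<close> recovers the
  vertex.\<close>

lemma inj_on_mult_add: "inj_on (\<lambda>v. f v * n + v) {..<n :: nat}"
proof (rule inj_onI)
  fix u v assume "u \<in> {..<n}" "v \<in> {..<n}" "f u * n + u = f v * n + v"
  then have "(f u * n + u) mod n = (f v * n + v) mod n" "u < n" "v < n" by simp_all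
  then show "u = v" by simp
qed

text \<open>Let u outside K have a larger key than v in K. If u is adjacent to all of K, it can be
  added. Otherwise u misses some w in K, and
  \<open>deg u \<le> card K - 1 \<le> deg v \<le> deg u\<close> forces equality throughout. This
  determines both neighbourhoods: w turns out to be v, and u and v are twins with neighbourhood K -
  {v}, so they can be swapped.\<close>

lemma split_part_threshold:
  assumes "split_part K0"
  shows "\<exists>\<theta>\<le>n * n + n. split_part {v\<in>{..<n}. \<theta> \<le> deg v * n + v}"
proof -
  let ?key = "\<lambda>v. deg v * n + v"
  have "\<exists>K\<in>Collect split_part. \<exists>\<theta>\<le>n * n + n. K = {v\<in>{..<n}. \<theta> \<le> ?key v}"
  proof (rule threshold_exchange)
    show "?key v < n * n + n" if "v \<in> {..<n}" for v
      using mult_le_mono1[OF deg_le, of v n] that unfolding lessThan_iff by linarith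
    fix K u v assume K: "K \<in> Collect split_part" and v: "v \<in> K" and u: "u \<in> {..<n} - K"
      and key: "?key v < ?key u"
    from K have Kn: "K \<subseteq> {..<n}" and cl: "\<And>u v. u \<in> K \<Longrightarrow> v \<in> K \<Longrightarrow> u \<noteq> v \<Longrightarrow> a u v = 1"
      and ind: "\<And>u v. u \<in> {..<n} - K \<Longrightarrow> v \<in> {..<n} - K \<Longrightarrow> u \<noteq> v \<Longrightarrow> a u v = 0"
      by (auto simp: split_part_def)
    have fin: "finite K" using Kn finite_subset by blast
    have vn: "v < n" and un: "u < n" and uK: "u \<notin> K" using u v Kn by auto
    show "\<exists>K'\<in>Collect split_part. sum ?key K < sum ?key K'"
    proof (cases "\<forall>w\<in>K. a u w = 1")
      case True
      have "a w u = 1" if "w \<in> K" for w using True that a_sym[of u w] un Kn by auto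
      with True have "split_part (insert u K)" using K u by (auto simp: split_part_def)
      \<comment> \<open>Only an isolated vertex 0 has key 0; it is excluded because key u exceeds
        another key.\<close>
      moreover have "0 < ?key u" using key by linarith
      then have "sum ?key K < sum ?key (insert u K)" using fin uK by simp
      ultimately show ?thesis by blast
    next
      case False
      then obtain w where w: "w \<in> K" "a u w \<noteq> 1" by blast
      then have w0: "a u w = 0" using a_le[of u w] by simp
      \<comment> \<open>All neighbours of u lie in K, since u belongs to the independent
        side.\<close>
      have Nu: "{y. y < n \<and> a u y \<noteq> 0} \<subseteq> K - {w}"
        using ind[of u] u w0 a_irrefl by (auto, metis neq0_conv)
      then have du: "deg u \<le> card K - 1" unfolding deg_eq_card
        using card_mono[OF _ Nu] fin w(1) by simp
      have Nv: "K - {v} \<subseteq> {y. y < n \<and> a v y \<noteq> 0}"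
        using cl[OF v] Kn by force
      then have dv: "card K - 1 \<le> deg v" unfolding deg_eq_card
        using card_mono[OF _ Nv] fin v by simp
      \<comment> \<open>The lexicographic order of the keys compares degrees before vertex
        numbers.\<close>
      have "deg v \<le> deg u"
      proof (rule ccontr)
        assume "\<not> deg v \<le> deg u"
        then have "Suc (deg u) * n \<le> deg v * n" by (intro mult_le_mono1) simp
        with key un show False by simp
      qed
      with du dv have d: "deg u = card K - 1" "deg v = card K - 1" by simp_all
      have Nu': "{y. y < n \<and> a u y \<noteq> 0} = K - {w}"
        by (rule card_subset_eq[OF _ Nu]) (use fin d w in \<open>simp_all add: deg_eq_card\<close>)
      have Nv': "K - {v} = {y. y < n \<and> a v y \<noteq> 0}"
        by (rule card_subset_eq[OF _ Nv]) (use fin d v in \<open>simp_all add: deg_eq_card\<close>)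
      have nu: "a u y \<noteq> 0 \<longleftrightarrow> y \<in> K - {w}" if "y < n" for y using Nu' that by blast
      have nv: "a v y \<noteq> 0 \<longleftrightarrow> y \<in> K - {v}" if "y < n" for y using Nv' that by blast
      \<comment> \<open>Otherwise v is a neighbour of u, so u is a neighbour of v; but all
        neighbours of v lie in K.\<close>
      have wv: "w = v"
      proof (rule ccontr)
        assume "w \<noteq> v"
        then have "a u v \<noteq> 0" using nu[OF vn] v by blast
        then show False using nv[OF un] uK a_sym[OF un vn] by simp
      qed
      have au: "a u y = 1" "a y u = 1" if "y \<in> K - {v}" for y
      proof -
        have "a u y \<noteq> 0" using that nu[of y] wv Kn by blast
        then show "a u y = 1" using a_le[of u y] by simp
        moreover have "y < n" using that Kn by blast
        ultimately show "a y u = 1" using a_sym[OF un, of y] by simp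
      qed
      have av: "a v y = 0" "a y v = 0" if "y < n" "y \<notin> K" for y
      proof -
        show "a v y = 0" using that nv[of y] by blast
        then show "a y v = 0" using a_sym[OF vn, of y] that by simp
      qed
      have "split_part (insert u (K - {v}))"
        unfolding split_part_def
      proof (intro conjI ballI impI)
        show "insert u (K - {v}) \<subseteq> {..<n}" using Kn un by auto
      next
        fix p q assume "p \<in> insert u (K - {v})" "q \<in> insert u (K - {v})" "p \<noteq> q"
        then show "a p q = 1" using au cl by auto
      next
        fix p q assume "p \<in> {..<n} - insert u (K - {v})" "q \<in> {..<n} - insert u (K - {v})" "p \<noteq> q"
        then show "a p q = 0" using av ind by (cases "p = v"; cases "q = v") auto
      qed
      moreover have "sum ?key K < sum ?key (insert u (K - {v}))"
        using key fin uK v sum.remove[OF fin v, of ?key] by simp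
      ultimately show ?thesis by blast
    qed
  next
    show "Collect split_part \<noteq> {}" using assms by blast
    show "K \<subseteq> {..<n}" if "K \<in> Collect split_part" for K
      using that by (simp add: split_part_def)
  qed (simp_all add: inj_on_mult_add)
  then show ?thesis by auto
qed

section \<open>Optimal completion of a fixed cut of S\<close>

text \<open>Since \<open>R\<close> is homogeneous, for a fixed part of the cut outside \<open>R\<close> the value depends only on
  the number of vertices of \<open>R\<close> on the first side and on the sum of their gains.\<close>

definition gain :: "nat set \<Rightarrow> (nat \<Rightarrow> nat) \<Rightarrow> nat \<Rightarrow> int" where
  "gain S x v = (\<Sum>u\<in>S. int (a v u) * (1 - 2 * int (x u)))"

text \<open>The second sum counts the cut edges between S and R when all of R has value 0; giving v
  the value 1 changes it by \<open>gain S x v\<close>. Within R all pairs are joined alike, so k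
  vertices of value 1 contribute c * k * (card R - k). Integers are needed because gains may be
  negative.\<close>

lemma cut_value_decompose:
  assumes "S \<inter> R = {}" "S \<union> R = {..<n}"
    and hom: "\<And>u v. u \<in> R \<Longrightarrow> v \<in> R \<Longrightarrow> u \<noteq> v \<Longrightarrow> a u v = c"
    and x: "\<And>v. x v \<le> 1"
  shows "int (cut_value x) =
    (\<Sum>u\<in>S. int (x u) * (\<Sum>v\<in>S. int (a u v) * (1 - int (x v)))) +
    (\<Sum>v\<in>R. \<Sum>u\<in>S. int (a v u) * int (x u)) + (\<Sum>v\<in>R. int (x v) * gain S x v) +
    int c * (\<Sum>v\<in>R. int (x v)) * (int (card R) - (\<Sum>v\<in>R. int (x v)))"
proof -
  have fin: "finite S" "finite R" using assms(2) by (metis finite_Un finite_lessThan)+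
  have un: "sum f {..<n} = sum f S + sum f R" for f :: "nat \<Rightarrow> int"
    unfolding assms(2)[symmetric] by (rule sum.union_disjoint) (use fin assms(1) in auto)
  define h where "h u v = int (a u v) * (1 - int (x v))" for u v
  have "int (cut_value x) = (\<Sum>u<n. int (x u) * (\<Sum>v<n. h u v))"
    unfolding cut_value_def h_def using x by (simp add: of_nat_diff)
  also have "\<dots> = (\<Sum>u\<in>S. int (x u) * sum (h u) S) + (\<Sum>u\<in>S. int (x u) * sum (h u) R) +
      ((\<Sum>u\<in>R. int (x u) * sum (h u) S) + (\<Sum>u\<in>R. int (x u) * sum (h u) R))"
    by (simp add: un distrib_left sum.distrib)
  also have "(\<Sum>u\<in>S. int (x u) * sum (h u) R) =
      (\<Sum>v\<in>R. \<Sum>u\<in>S. int (x u) * int (a v u) * (1 - int (x v)))"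
    unfolding sum_distrib_left
    by (subst sum.swap, intro sum.cong refl) (use assms(2) a_sym in \<open>auto simp: h_def\<close>)
  also have "(\<Sum>u\<in>R. int (x u) * sum (h u) R) =
      int c * (\<Sum>v\<in>R. int (x v)) * (int (card R) - (\<Sum>v\<in>R. int (x v)))"
  proof -
    have "(\<Sum>u\<in>R. int (x u) * sum (h u) R) =
        (\<Sum>u\<in>R. \<Sum>v\<in>R. int (x u) * (int c * (1 - int (x v))))"
      unfolding sum_distrib_left
    proof (intro sum.cong refl)
      fix u v assume "u \<in> R" "v \<in> R"
      moreover have "x u = 0 \<or> x u = 1" using x[of u] by auto
      \<comment> \<open>On the diagonal x u * (1 - x u) is 0, so replacing the matrix entry by
        \<open>c\<close> is right there too.\<close>
      ultimately show "int (x u) * h u v = int (x u) * (int c * (1 - int (x v)))"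
        unfolding h_def by (cases "u = v") (auto simp: hom)
    qed
    also have "\<dots> = (\<Sum>u\<in>R. int (x u)) * (\<Sum>v\<in>R. int c * (1 - int (x v)))"
      by (rule sum_product[symmetric])
    finally show ?thesis by (simp add: sum_distrib_left[symmetric] sum_subtractf algebra_simps)
  qed
  finally have split: "int (cut_value x) = (\<Sum>u\<in>S. int (x u) * sum (h u) S) +
      (\<Sum>v\<in>R. \<Sum>u\<in>S. int (x u) * int (a v u) * (1 - int (x v))) +
      ((\<Sum>u\<in>R. int (x u) * sum (h u) S) +
        int c * (\<Sum>v\<in>R. int (x v)) * (int (card R) - (\<Sum>v\<in>R. int (x v))))" .
  \<comment> \<open>For one edge, both directions together give x u * (1 - x v) + x v * (1 - x u) =
    x u + x v * (1 - 2 * x u).\<close>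
  have "(\<Sum>u\<in>R. int (x u) * sum (h u) S) +
      (\<Sum>v\<in>R. \<Sum>u\<in>S. int (x u) * int (a v u) * (1 - int (x v))) =
      (\<Sum>v\<in>R. \<Sum>u\<in>S. int (a v u) * int (x u)) + (\<Sum>v\<in>R. int (x v) * gain S x v)"
    unfolding sum.distrib[symmetric] gain_def sum_distrib_left h_def
    by (intro sum.cong refl) (simp add: algebra_simps)
  with split show ?thesis unfolding h_def by linarith
qed

lemma gain_cong: "(\<And>u. u \<in> S \<Longrightarrow> x u = y u) \<Longrightarrow> gain S x = gain S y"
  by (auto simp: gain_def fun_eq_iff intro!: sum.cong)

text \<open>By the decomposition, among cuts that agree on S and put equally many vertices of R on
  the first side, only the sum of gains matters. The threshold is good for every such
  \<open>y\<close>, because the candidate to which this is applied is itself defined from the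
  threshold. Its bound comes from scores of at most 2 * n.\<close>

lemma top_gain_optimal:
  fixes g :: "nat \<Rightarrow> nat"
  assumes "S \<inter> R = {}" "S \<union> R = {..<n}"
    and hom: "\<And>u v. u \<in> R \<Longrightarrow> v \<in> R \<Longrightarrow> u \<noteq> v \<Longrightarrow> a u v = c"
    and x: "\<And>v. x v \<le> 1"
    and g: "\<And>v. v \<in> R \<Longrightarrow> int (g v) = int n + gain S x v"
    and g_le: "\<And>v. v \<in> R \<Longrightarrow> g v \<le> 2 * n"
  shows "\<exists>\<theta>\<le>2 * n * n + n. \<forall>y. (\<forall>v. y v \<le> 1) \<longrightarrow> (\<forall>v\<in>S. y v = x v) \<longrightarrow>
    (\<forall>v\<in>R. y v = (if \<theta> \<le> g v * n + v then 1 else 0)) \<longrightarrow> cut_value x \<le> cut_value y"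
proof -
  let ?key = "\<lambda>v. g v * n + v"
  have fin: "finite S" "finite R" using assms(2) by (metis finite_Un finite_lessThan)+
  define X where "X = {v\<in>R. x v = 1}"
  have sumX: "(\<Sum>v\<in>R. int (y v) * f v) = sum f {v\<in>R. y v = 1}" if "\<And>v. y v \<le> 1"
    for y :: "nat \<Rightarrow> nat" and f :: "nat \<Rightarrow> int"
  proof -
    have "y v = 0 \<or> y v = 1" for v using that[of v] by auto
    then have "(\<Sum>v\<in>R. int (y v) * f v) = (\<Sum>v\<in>R. if y v = 1 then f v else 0)"
      by (intro sum.cong refl) (metis int_ops(1) int_ops(2) mult_1 mult_zero_left)
    then show ?thesis using fin(2) by (simp add: sum.inter_filter)
  qed
  \<comment> \<open>Swapping a member for a vertex of larger key keeps the size and, as the key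
    order refines the gain order, does not lower the gain; so this family is closed under
    exchange.\<close>
  let ?F = "{T. T \<subseteq> R \<and> card T = card X \<and> sum (gain S x) X \<le> sum (gain S x) T}"
  have "\<exists>T\<in>?F. \<exists>\<theta>\<le>2 * n * n + n. T = {v\<in>R. \<theta> \<le> ?key v}"
  proof (rule threshold_exchange)
    show "?F \<noteq> {}" using X_def by auto
    show "inj_on ?key R" using inj_on_mult_add assms(2) by (metis Un_upper2 inj_on_subset)
    show "?key v < 2 * n * n + n" if "v \<in> R" for v
    proof -
      have "v < n" using that assms(2) by auto
      then show ?thesis using mult_le_mono1[OF g_le[OF that], of n] by linarith
    qed
    fix T u v assume T: "T \<in> ?F" and v: "v \<in> T" and u: "u \<in> R - T" and key: "?key v < ?key u"
    have finT: "finite T" using T fin(2) finite_subset by blast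
    have "g v \<le> g u"
    proof (rule ccontr)
      assume "\<not> g v \<le> g u"
      then have "Suc (g u) * n \<le> g v * n" by (intro mult_le_mono1) simp
      moreover have "u < n" using u assms(2) by auto
      ultimately show False using key by simp
    qed
    then have "gain S x v \<le> gain S x u" using g[of u] g[of v] u v T by auto
    then have "sum (gain S x) T \<le> sum (gain S x) (insert u (T - {v}))"
      using finT u v sum.remove[OF finT v, of "gain S x"] by simp
    moreover have "card (insert u (T - {v})) = card T" using finT u v
      by (metis DiffD2 Diff_insert_absorb card_insert_disjoint finite_Diff insert_Diff insertE insert_iff)
    ultimately have "insert u (T - {v}) \<in> ?F" using T u by auto
    moreover have "sum ?key T < sum ?key (insert u (T - {v}))"
      using key finT u v sum.remove[OF finT v, of ?key] by simp
    ultimately show "\<exists>T'\<in>?F. sum ?key T < sum ?key T'" by blast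
  qed (use fin in auto)
  then obtain \<theta> where \<theta>: "\<theta> \<le> 2 * n * n + n" "card {v\<in>R. \<theta> \<le> ?key v} = card X"
    "sum (gain S x) X \<le> sum (gain S x) {v\<in>R. \<theta> \<le> ?key v}" by auto
  show ?thesis
  proof (intro exI[of _ \<theta>] conjI \<theta>(1) allI impI)
    fix y :: "nat \<Rightarrow> nat"
    assume y: "\<forall>v. y v \<le> 1" "\<forall>v\<in>S. y v = x v" "\<forall>v\<in>R. y v = (if \<theta> \<le> ?key v then 1 else 0)"
    have Y: "{v\<in>R. y v = 1} = {v\<in>R. \<theta> \<le> ?key v}" using y(3) by (auto split: if_splits)
    have gS: "gain S y = gain S x" using y(2) by (intro gain_cong) auto
    have card: "(\<Sum>v\<in>R. int (y v)) = (\<Sum>v\<in>R. int (x v))"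
      using sumX[of y "\<lambda>_. 1"] sumX[of x "\<lambda>_. 1"] x y(1) Y \<theta>(2) X_def by simp
    have le: "(\<Sum>v\<in>R. int (x v) * gain S x v) \<le> (\<Sum>v\<in>R. int (y v) * gain S x v)"
      using sumX[of y "gain S x"] sumX[of x "gain S x"] x y(1) Y \<theta>(3) X_def by simp
    have S: "(\<Sum>u\<in>S. int (y u) * (\<Sum>v\<in>S. int (a u v) * (1 - int (y v)))) =
        (\<Sum>u\<in>S. int (x u) * (\<Sum>v\<in>S. int (a u v) * (1 - int (x v))))"
      "(\<Sum>v\<in>R. \<Sum>u\<in>S. int (a v u) * int (y u)) = (\<Sum>v\<in>R. \<Sum>u\<in>S. int (a v u) * int (x u))"
      using y(2) by simp_all
    note dx = cut_value_decompose[OF assms(1,2) hom, of x]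
      and dy = cut_value_decompose[OF assms(1,2) hom, of y]
    have "int (cut_value x) \<le> int (cut_value y)"
      using dx[OF _ _ _ x] dy[OF _ _ _ y(1)[rule_format]] le unfolding S gS card by linarith
    then show "cut_value x \<le> cut_value y" by simp
  qed
qed

section \<open>Cuts of S as binary masks\<close>

text \<open>The vertices of \<open>S\<close> consume the binary digits of \<open>m\<close> from the most significant one on; with
  \<open>m < 2 ^ h\<close> that digit is 1 iff \<open>2 ^ h \<le> 2 * m\<close>, so no division is needed.\<close>

fun digits_left :: "nat \<Rightarrow> (nat \<Rightarrow> bool) \<Rightarrow> nat \<Rightarrow> nat \<Rightarrow> nat" where
  "digits_left M S m 0 = m"
| "digits_left M S m (Suc v) = (let k = digits_left M S m v in
     if S v then (if M \<le> 2 * k then 2 * k - M else 2 * k) else k)"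

text \<open>The inverse of \<open>digits_left\<close>, built from the last vertex downwards: a
  vertex of S pushes its digit in at the top of h positions. After \<open>k\<close> steps the value
  is what \<open>digits_left\<close> must still hold on reaching vertex
  \<open>n - k\<close>.\<close>

fun encode_digits :: "nat \<Rightarrow> (nat \<Rightarrow> bool) \<Rightarrow> (nat \<Rightarrow> nat) \<Rightarrow> nat \<Rightarrow> nat" where
  "encode_digits h S x 0 = 0"
| "encode_digits h S x (Suc k) = (let v = n - Suc k; m = encode_digits h S x k in
     if S v then m div 2 + (if x v = 1 then 2 ^ (h - 1) else 0) else m)"

text \<open>When c vertices of S have been handled, only the top c of the h positions can be
  nonzero. The divisibility ensures that halving never drops a digit.\<close>

lemma encode_digits_bound:
  assumes "k \<le> n" "card {v. n - k \<le> v \<and> v < n \<and> S v} \<le> h"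
  shows "encode_digits h S x k < 2 ^ h \<and>
    2 ^ (h - card {v. n - k \<le> v \<and> v < n \<and> S v}) dvd encode_digits h S x k"
  using assms
proof (induction k)
  case 0
  then show ?case by simp
next
  case (Suc k)
  let ?v = "n - Suc k" and ?m = "encode_digits h S x k"
  let ?C = "{v. n - k \<le> v \<and> v < n \<and> S v}"
  have fin: "finite ?C" by (rule finite_subset[of _ "{..<n}"]) auto
  show ?case
  proof (cases "S ?v")
    case True
    have C: "{v. ?v \<le> v \<and> v < n \<and> S v} = insert ?v ?C"
    proof -
      have "?v \<le> v \<longleftrightarrow> v = ?v \<or> n - k \<le> v" for v using Suc.prems(1) by auto
      moreover have "?v < n" using Suc.prems(1) by auto
      ultimately show ?thesis using True by auto
    qed
    have "?v \<notin> ?C" using Suc.prems(1) by auto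
    with C fin have card: "card {v. ?v \<le> v \<and> v < n \<and> S v} = Suc (card ?C)" by simp
    with Suc.prems have h: "Suc (card ?C) \<le> h" by simp
    with Suc have IH: "?m < 2 ^ h" "2 ^ (h - card ?C) dvd ?m" by auto
    let ?j = "h - Suc (card ?C)"
    have "h - card ?C = Suc ?j" using h by simp
    with IH(2) obtain q where q: "?m = 2 ^ Suc ?j * q" by (metis dvdE)
    then have "?m div 2 = 2 ^ ?j * q" by simp
    then have "2 ^ ?j dvd ?m div 2" by simp
    moreover have "(2::nat) ^ ?j dvd 2 ^ (h - 1)" by (rule le_imp_power_dvd) simp
    moreover have "(2::nat) ^ h = 2 * 2 ^ (h - 1)" using h by (cases h) auto
    ultimately show ?thesis using True IH(1) card by (auto simp: Let_def)
  next
    case False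
    have "{v. ?v \<le> v \<and> v < n \<and> S v} = ?C"
    proof -
      have "?v \<le> v \<longleftrightarrow> v = ?v \<or> n - k \<le> v" for v using Suc.prems(1) by auto
      then show ?thesis using False by auto
    qed
    with False Suc show ?thesis by (auto simp: Let_def)
  qed
qed

lemma encode_digits_step:
  assumes "v < n" "card {v. v < n \<and> S v} \<le> h" "S v"
  shows "2 * encode_digits h S x (n - v) = encode_digits h S x (n - Suc v) + (if x v = 1 then 2 ^ h else 0)"
    "encode_digits h S x (n - Suc v) < 2 ^ h"
proof -
  let ?m = "encode_digits h S x (n - Suc v)"
  let ?C = "{u. Suc v \<le> u \<and> u < n \<and> S u}"
  have s: "n - v = Suc (n - Suc v)" using assms(1) by simp
  have "card (insert v ?C) \<le> card {v. v < n \<and> S v}"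
    by (rule card_mono) (use assms in auto)
  moreover have "finite ?C" by (rule finite_subset[of _ "{..<n}"]) auto
  ultimately have c: "Suc (card ?C) \<le> h" using assms(2) by simp
  have "n - (n - Suc v) = Suc v" using assms(1) by simp
  with encode_digits_bound[of "n - Suc v" S h x] c
  have b: "?m < 2 ^ h" "2 ^ (h - card ?C) dvd ?m" by auto
  have "(2::nat) dvd 2 ^ (h - card ?C)" using c by (simp add: dvd_power)
  then have "even ?m" using b(2) dvd_trans by blast
  moreover have "(2::nat) ^ h = 2 * 2 ^ (h - 1)" using c by (cases h) auto
  moreover have "n - Suc (n - Suc v) = v" using assms(1) by simp
  ultimately show "2 * encode_digits h S x (n - v) = ?m + (if x v = 1 then 2 ^ h else 0)"
    unfolding s using assms(3) by (simp add: Let_def)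
  show "?m < 2 ^ h" by (rule b(1))
qed

lemma digits_left_encode:
  assumes "card {v. v < n \<and> S v} \<le> h" "v \<le> n"
  shows "digits_left (2 ^ h) S (encode_digits h S x n) v = encode_digits h S x (n - v)"
  using assms(2)
proof (induction v)
  case (Suc v)
  then have IH: "digits_left (2 ^ h) S (encode_digits h S x n) v = encode_digits h S x (n - v)" by simp
  show ?case
  proof (cases "S v")
    case True
    show ?thesis using encode_digits_step[OF _ assms(1) True, of x] Suc.prems True IH
      by (auto simp: Let_def)
  next
    case False
    moreover have "n - v = Suc (n - Suc v)" "n - Suc (n - Suc v) = v" using Suc.prems by auto
    ultimately have "encode_digits h S x (n - v) = encode_digits h S x (n - Suc v)"
      by (simp add: Let_def)
    with IH False show ?thesis by (simp add: Let_def)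
  qed
qed simp

text \<open>Since all masks are tried, it matters only that every assignment to S is reached; this
  holds also when S has fewer than \<open>h\<close> elements.\<close>

lemma ex_mask:
  assumes "card {v. v < n \<and> S v} \<le> h"
  shows "\<exists>m<2 ^ h. \<forall>v<n. S v \<longrightarrow> (2 ^ h \<le> 2 * digits_left (2 ^ h) S m v \<longleftrightarrow> x v = (1::nat))"
proof (intro exI[of _ "encode_digits h S x n"] conjI allI impI)
  show "encode_digits h S x n < 2 ^ h" using encode_digits_bound[of n S h x] assms by simp
  fix v assume "v < n" "S v"
  then show "2 ^ h \<le> 2 * digits_left (2 ^ h) S (encode_digits h S x n) v \<longleftrightarrow> x v = 1"
    using digits_left_encode[OF assms, of v x] encode_digits_step[OF _ assms, of v x] by auto
qed

section \<open>Candidate cuts and the existence of an optimal one\<close>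

definition in_part :: "nat \<Rightarrow> nat \<Rightarrow> nat \<Rightarrow> bool" where
  "in_part p q v \<longleftrightarrow> p \<le> deg v * n + v \<and> deg v * n + v < q"

text \<open>Marks 0 and 2 stand for the two sides of the cut of \<open>S\<close> and 1 for a vertex outside \<open>S\<close>, so that
  a score is \<open>n\<close> plus a gain and truncated subtraction does no harm.\<close>

definition mark :: "nat \<Rightarrow> nat \<Rightarrow> nat \<Rightarrow> nat \<Rightarrow> nat" where
  "mark m p q v = (if in_part p q v then
     (if 2 ^ (n div 2) \<le> 2 * digits_left (2 ^ (n div 2)) (in_part p q) m v then 0 else 2) else 1)"

definition score :: "nat \<Rightarrow> nat \<Rightarrow> nat \<Rightarrow> nat \<Rightarrow> nat" where
  "score m p q v = (\<Sum>u<n. 1 + a v u * mark m p q u - a v u)"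

text \<open>With truncated subtraction, 1 - (1 - z) is the truth value of z being nonzero. Mark 0
  makes the first summand 1 and mark 2 makes both summands 0, which fixes the side; for mark 1 only
  the last difference remains, nonzero iff \<theta> is at most the score key.\<close>

definition candidate :: "nat \<Rightarrow> nat \<Rightarrow> nat \<Rightarrow> nat \<Rightarrow> nat \<Rightarrow> nat" where
  "candidate m p q \<theta> v = 1 - (1 - ((1 - mark m p q v) +
     (2 - mark m p q v) * (score m p q v * n + v + 1 - \<theta>)))"

lemma candidate_le: "candidate m p q \<theta> v \<le> 1"
  by (simp add: candidate_def)

lemma mark_le: "mark m p q v \<le> 2"
  by (simp add: mark_def)

lemma score_le: "score m p q v \<le> 2 * n"
proof -
  have "1 + a v u * mark m p q u - a v u \<le> 2" for u
    using a_le[of v u] mark_le[of m p q u] by (cases "a v u") auto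
  then show ?thesis unfolding score_def
    using sum_bounded_above[of "{..<n}" "\<lambda>u. 1 + a v u * mark m p q u - a v u" 2] by simp
qed

lemma candidate_optimal_for_part:
  assumes "card {v. v < n \<and> in_part p q v} \<le> n div 2"
    and hom: "\<And>u v. \<lbrakk>u < n; v < n; \<not> in_part p q u; \<not> in_part p q v; u \<noteq> v\<rbrakk> \<Longrightarrow> a u v = c"
    and x: "\<And>v. x v \<le> 1"
  shows "\<exists>m<2 ^ (n div 2). \<exists>\<theta>\<le>2 * n * n + n. cut_value x \<le> cut_value (candidate m p q \<theta>)"
proof -
  let ?S = "{v. v < n \<and> in_part p q v}" and ?R = "{v. v < n \<and> \<not> in_part p q v}"
  obtain m where m: "m < 2 ^ (n div 2)" "\<And>v. v < n \<Longrightarrow> in_part p q v \<Longrightarrow>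
      2 ^ (n div 2) \<le> 2 * digits_left (2 ^ (n div 2)) (in_part p q) m v \<longleftrightarrow> x v = 1"
    using ex_mask[OF assms(1), of x] by blast
  have marked: "int (mark m p q v) = 2 * (1 - int (x v))" if "v \<in> ?S" for v
    using that m(2)[of v] x[of v] by (auto simp: mark_def)
  have unmarked: "mark m p q v = 1" if "v \<in> ?R" for v using that by (simp add: mark_def)
  have score: "int (score m p q v) = int n + gain ?S x v" for v
  proof -
    have "int (score m p q v) = (\<Sum>u<n. 1 + int (a v u) * (int (mark m p q u) - 1))"
      unfolding score_def of_nat_sum
    proof (intro sum.cong refl)
      fix u
      have "a v u = 0 \<or> a v u = 1" using a_le[of v u] by auto
      then show "int (1 + a v u * mark m p q u - a v u) = 1 + int (a v u) * (int (mark m p q u) - 1)"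
        by auto
    qed
    also have "\<dots> = int n + (\<Sum>u<n. int (a v u) * (int (mark m p q u) - 1))"
      by (simp add: sum.distrib)
    \<comment> \<open>On S, \<open>mark - 1\<close> is the factor 1 - 2 * x u of the gain; outside S
      it is 0.\<close>
    also have "(\<Sum>u<n. int (a v u) * (int (mark m p q u) - 1)) = gain ?S x v"
      unfolding gain_def by (rule sum.mono_neutral_cong_right) (use marked unmarked in auto)
    finally show ?thesis .
  qed
  obtain \<theta> where \<theta>: "\<theta> \<le> 2 * n * n + n" "\<And>y. (\<forall>v. y v \<le> 1) \<Longrightarrow> (\<forall>v\<in>?S. y v = x v) \<Longrightarrow>
    (\<forall>v\<in>?R. y v = (if \<theta> \<le> score m p q v * n + v then 1 else 0)) \<Longrightarrow> cut_value x \<le> cut_value y"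
    using top_gain_optimal[of ?S ?R c x "score m p q"] hom x score score_le by fastforce
  have "cut_value x \<le> cut_value (candidate m p q \<theta>)"
  proof (rule \<theta>(2))
    show "\<forall>v\<in>?S. candidate m p q \<theta> v = x v"
    proof
      fix v assume v: "v \<in> ?S"
      have "x v = 0 \<or> x v = 1" using x[of v] by auto
      then show "candidate m p q \<theta> v = x v" using marked[OF v] by (auto simp: candidate_def)
    qed
    show "\<forall>v\<in>?R. candidate m p q \<theta> v = (if \<theta> \<le> score m p q v * n + v then 1 else 0)"
      using unmarked by (auto simp: candidate_def)
  qed (use candidate_le in auto)
  with m(1) \<theta>(1) show ?thesis by blast
qed

text \<open>One side of the threshold partition has at most \<open>n div 2\<close> vertices and is
  taken as S. Degree keys need only the range up to n * n + n; all three thresholds get the larger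
  range of the score keys, so that one loop bound serves them all.\<close>

lemma candidate_optimal:
  assumes "split_part K" and x: "\<And>v. x v \<le> 1"
  shows "\<exists>m<2 ^ (n div 2). \<exists>p\<le>2 * n * n + n. \<exists>q\<le>2 * n * n + n. \<exists>\<theta>\<le>2 * n * n + n.
    cut_value x \<le> cut_value (candidate m p q \<theta>)"
proof -
  let ?K = "\<lambda>\<sigma>. {v\<in>{..<n}. \<sigma> \<le> deg v * n + v}"
  obtain \<sigma> where \<sigma>: "\<sigma> \<le> n * n + n" "split_part (?K \<sigma>)"
    using split_part_threshold[OF assms(1)] by blast
  then have cl: "\<And>u v. u \<in> ?K \<sigma> \<Longrightarrow> v \<in> ?K \<sigma> \<Longrightarrow> u \<noteq> v \<Longrightarrow> a u v = 1"
    and ind: "\<And>u v. u \<in> {..<n} - ?K \<sigma> \<Longrightarrow> v \<in> {..<n} - ?K \<sigma> \<Longrightarrow> u \<noteq> v \<Longrightarrow> a u v = 0"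
    unfolding split_part_def by blast+
  have \<sigma>': "\<sigma> \<le> 2 * n * n + n" using \<sigma>(1) by simp
  have less: "deg v * n + v < n * n + n" if "v < n" for v
    using mult_le_mono1[OF deg_le, of v n] that by linarith
  show ?thesis
  proof (cases "card (?K \<sigma>) \<le> n div 2")
    case True
    \<comment> \<open>This exceeds every degree key, so the interval is the whole clique; the
      remaining part is independent.\<close>
    let ?q = "n * n + n"
    have "{v. v < n \<and> in_part \<sigma> ?q v} = ?K \<sigma>" using less by (auto simp: in_part_def)
    with True have "card {v. v < n \<and> in_part \<sigma> ?q v} \<le> n div 2" by simp
    moreover have "a u v = 0" if "u < n" "v < n" "\<not> in_part \<sigma> ?q u" "\<not> in_part \<sigma> ?q v" "u \<noteq> v" for u v
      using ind[of u v] that less by (auto simp: in_part_def)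
    ultimately have "\<exists>m<2 ^ (n div 2). \<exists>\<theta>\<le>2 * n * n + n. cut_value x \<le> cut_value (candidate m \<sigma> ?q \<theta>)"
      by (rule candidate_optimal_for_part[OF _ _ x])
    moreover have "?q \<le> 2 * n * n + n" by simp
    ultimately show ?thesis using \<sigma>' by blast
  next
    case False
    \<comment> \<open>Now S is the independent side, an initial segment of the keys, and the
      remaining part is a clique.\<close>
    have "{v. v < n \<and> in_part 0 \<sigma> v} = {..<n} - ?K \<sigma>" by (auto simp: in_part_def)
    moreover have "card ({..<n} - ?K \<sigma>) = n - card (?K \<sigma>)" by (subst card_Diff_subset) auto
    ultimately have "card {v. v < n \<and> in_part 0 \<sigma> v} \<le> n div 2" using False by simp
    moreover have "a u v = 1" if "u < n" "v < n" "\<not> in_part 0 \<sigma> u" "\<not> in_part 0 \<sigma> v" "u \<noteq> v" for u v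
      using cl[of u v] that by (auto simp: in_part_def)
    ultimately have "\<exists>m<2 ^ (n div 2). \<exists>\<theta>\<le>2 * n * n + n. cut_value x \<le> cut_value (candidate m 0 \<sigma> \<theta>)"
      by (rule candidate_optimal_for_part[OF _ _ x])
    then show ?thesis using \<sigma>' by blast
  qed
qed

end

section \<open>The program\<close>

text \<open>The arrays lie behind the matrix, which has to stay intact because every candidate reads
  it again.\<close>

definition cell :: "nat \<Rightarrow> nat \<Rightarrow> expr" where
  "cell j x = Plus (Plus (Times (Reg 0) (Reg 0)) (Times (Const j) (Reg 0))) (Reg x)"

definition adj :: expr where
  "adj = Load (Plus (Times (Reg 7) (Reg 0)) (Reg 8))"

text \<open>Register 9 holds the degree of the vertex in \<open>mark_com\<close> and its score in
  \<open>candidate_com\<close>, so the same expression gives both kinds of key.\<close>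

definition key :: expr where
  "key = Plus (Times (Reg 9) (Reg 0)) (Reg 7)"

lemma val_cell [simp]: "val s (cell j x) = fst s 0 * fst s 0 + j * fst s 0 + fst s x"
  by (simp add: cell_def)

lemma expr_size_cell [simp]: "expr_size (cell j x) = j + 9"
  by (simp add: cell_def)

lemma val_adj [simp]: "val s adj = snd s (fst s 7 * fst s 0 + fst s 8)"
  by (simp add: adj_def)

lemma expr_size_adj [simp]: "expr_size adj = 6"
  by (simp add: adj_def)

lemma val_key [simp]: "val s key = fst s 9 * fst s 0 + fst s 7"
  by (simp add: key_def)

lemma expr_size_key [simp]: "expr_size key = 5"
  by (simp add: key_def)

text \<open>Registers: 0 holds \<open>n\<close>, 1 holds \<open>2 ^ (n div 2)\<close>, 2 to 5 hold the parameters of the current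
  candidate, 6 holds the best value found so far, 7 and 8 are vertices, 9 is an accumulator, 10 holds
  the remaining digits, 11 the value of the candidate. The cells from \<open>n * n\<close> on hold three arrays of
  length \<open>n\<close>: the marks, the candidate cut, and the best cut.\<close>

definition mark_com :: com where
  "mark_com = Seq (Assign 10 (Reg 2)) (For 7 (Reg 0) (Seq (Sum 9 8 adj)
     (If (Times (Minus (Plus key (Const 1)) (Reg 3)) (Minus (Reg 4) key))
       (If (Minus (Plus (Times (Const 2) (Reg 10)) (Const 1)) (Reg 1))
         (Seq (Store (cell 0 7) (Const 0)) (Assign 10 (Minus (Times (Const 2) (Reg 10)) (Reg 1))))
         (Seq (Store (cell 0 7) (Const 2)) (Assign 10 (Times (Const 2) (Reg 10)))))
       (Store (cell 0 7) (Const 1)))))"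

definition candidate_com :: com where
  "candidate_com = For 7 (Reg 0) (Seq
     (Sum 9 8 (Minus (Plus (Const 1) (Times adj (Load (cell 0 8)))) adj))
     (Store (cell 1 7) (Minus (Const 1) (Minus (Const 1)
       (Plus (Minus (Const 1) (Load (cell 0 7)))
         (Times (Minus (Const 2) (Load (cell 0 7))) (Minus (Plus key (Const 1)) (Reg 5))))))))"

definition value_com :: com where
  "value_com = Seq (Assign 11 (Const 0)) (For 7 (Reg 0) (Seq
     (Sum 9 8 (Times adj (Minus (Const 1) (Load (cell 1 8)))))
     (Assign 11 (Plus (Reg 11) (Times (Load (cell 1 7)) (Reg 9))))))"

definition update_com :: com where
  "update_com = If (Minus (Reg 11) (Reg 6))
     (Seq (Assign 6 (Reg 11)) (For 7 (Reg 0) (Store (cell 2 7) (Load (cell 1 7))))) Skip"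

definition try_com :: com where
  "try_com = Seq mark_com (Seq candidate_com (Seq value_com update_com))"

text \<open>One more than the largest threshold 2 * n * n + n, since \<open>For\<close> stops before
  its bound.\<close>

definition limit :: expr where
  "limit = Plus (Times (Reg 0) (Plus (Times (Const 2) (Reg 0)) (Const 1))) (Const 1)"

text \<open>Doubling takes place in the rounds i with 2 * i + 1 < n, that is i < n div 2, which
  avoids a division.\<close>

definition init_com :: com where
  "init_com = Seq (Assign 1 (Const 1)) (For 7 (Reg 0)
     (If (Minus (Reg 0) (Plus (Times (Const 2) (Reg 7)) (Const 1)))
       (Assign 1 (Times (Const 2) (Reg 1))) Skip))"

definition search_com :: com where
  "search_com = For 2 (Reg 1) (For 3 limit (For 4 limit (For 5 limit try_com)))"

definition output_com :: com where
  "output_com = For 7 (Reg 0) (Store (Reg 7) (Load (cell 2 7)))"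

definition program :: com where
  "program = Seq init_com (Seq search_com output_com)"

lemma (in bounded_ram) runs_Skip: "Q s \<Longrightarrow> runs Skip s unit_cost Q"
  using exec.Skip[of s] l_pos unfolding runs_def unit_cost_def
  by (intro exI[of _ 1] exI[of _ s]) simp

text \<open>The stored numbers are at most 8 * (n + 1) * (n + 1), or at most 2 * 2 ^ (n div 2) for
  masks and digits. Both are below 2 ^ (2 * n + 4) = 16 * 2 ^ n * 2 ^ n. A word length linear in n
  suits masks of about n / 2 bits.\<close>

sublocale adjacency \<subseteq> bounded_ram "2 * n + 4"
  by unfold_locales simp

section \<open>Machine states and the stages of a single trial\<close>

context adjacency
begin

definition M :: nat where "M = 2 ^ (n div 2)"

definition base :: "state \<Rightarrow> bool" where
  "base s \<longleftrightarrow> fst s 0 = n \<and> fst s 1 = M \<and> (\<forall>u<n. \<forall>v<n. snd s (u * n + v) = a u v) \<and>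
     bounded_state (2 * n + 4) s"

definition arr :: "nat \<Rightarrow> (nat \<Rightarrow> nat) \<Rightarrow> state \<Rightarrow> bool" where
  "arr j f s \<longleftrightarrow> (\<forall>v<n. snd s (n * n + j * n + v) = f v)"

lemma index_less: "u < n \<Longrightarrow> v < n \<Longrightarrow> u * n + v < n * n"
proof -
  assume "u < n" "v < n"
  then have "Suc u * n \<le> n * n" by (intro mult_le_mono1) simp
  with \<open>v < n\<close> show ?thesis by simp
qed

lemma small: "k \<le> 8 * (n + 1) * (n + 1) \<Longrightarrow> k < 2 ^ (2 * n + 4)"
proof -
  assume k: "k \<le> 8 * (n + 1) * (n + 1)"
  have n: "n + 1 \<le> 2 ^ n" using less_exp[of n] by (simp add: Suc_le_eq)
  have "(n + 1) * (n + 1) \<le> 2 ^ n * 2 ^ n" by (rule mult_mono[OF n n]) auto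
  moreover have "(2::nat) ^ (2 * n + 4) = 16 * (2 ^ n * 2 ^ n)"
    unfolding mult_2 power_add by simp
  moreover have "(0::nat) < 2 ^ n * 2 ^ n" by simp
  ultimately show ?thesis using k by linarith
qed

lemma M_small: "k \<le> 2 * M \<Longrightarrow> k < 2 ^ (2 * n + 4)"
proof -
  assume "k \<le> 2 * M"
  also have "2 * M = 2 ^ (n div 2 + 1)" by (simp add: M_def)
  also have "\<dots> < 2 ^ (2 * n + 4)" by (rule power_strict_increasing) auto
  finally show ?thesis .
qed

lemma base_reg: "base (f, m) \<Longrightarrow> x \<noteq> 0 \<Longrightarrow> x \<noteq> 1 \<Longrightarrow> k < 2 ^ (2 * n + 4) \<Longrightarrow> base (f(x := k), m)"
  by (auto simp: base_def bounded_state_def)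

lemma base_mem: "base (f, m) \<Longrightarrow> n * n \<le> i \<Longrightarrow> k < 2 ^ (2 * n + 4) \<Longrightarrow> base (f, m(i := k))"
  using index_less unfolding base_def bounded_state_def by (auto simp: not_le[symmetric])

lemma base_bounded: "base s \<Longrightarrow> bounded_state (2 * n + 4) s"
  by (simp add: base_def)

lemma baseD: "base s \<Longrightarrow> fst s 0 = n" "base s \<Longrightarrow> fst s 1 = M"
  "base s \<Longrightarrow> u < n \<Longrightarrow> v < n \<Longrightarrow> snd s (u * n + v) = a u v"
  by (simp_all add: base_def)

lemma vertex_small: "v \<le> n \<Longrightarrow> v < 2 ^ (2 * n + 4)"
  by (rule small) simp

lemma base_vertex: "base (f, m) \<Longrightarrow> x \<noteq> 0 \<Longrightarrow> x \<noteq> 1 \<Longrightarrow> k \<le> n \<Longrightarrow> base (f(x := k), m)"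
  using base_reg vertex_small by blast

lemma base_digit: "base (f, m) \<Longrightarrow> n * n \<le> i \<Longrightarrow> k \<le> 2 \<Longrightarrow> base (f, m(i := k))"
  by (rule base_mem) (auto intro: small)

lemma runs_vertex_Sum:
  assumes "base s" "expr_size e \<le> 48"
    and val: "\<And>u k. u < n \<Longrightarrow> val ((fst s)(8 := u, 9 := k), snd s) e = f u"
    and f: "\<And>u. u < n \<Longrightarrow> f u \<le> 2"
  shows "runs (Sum 9 8 e) s (5 * unit_cost * (n + 1))
    (\<lambda>s'. s' = ((fst s)(8 := n, 9 := \<Sum>u<n. f u), snd s) \<and> base s')"
proof -
  have n: "fst s 0 = n" using assms(1) by (simp add: base_def)
  have "(\<Sum>u<n. f u) \<le> n * 2" using sum_bounded_above[of "{..<n}" f 2] f by simp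
  then have le: "(\<Sum>u<n. f u) < 2 ^ (2 * n + 4)" by (intro small) simp
  have "runs (Sum 9 8 e) s (5 * unit_cost * (n + 1))
    (\<lambda>s'. s' = ((fst s)(8 := n, 9 := \<Sum>u<n. f u), snd s))"
    using runs_Sum[of s e 9 8 f, unfolded n] assms(1,2) val le n vertex_small[of n]
    by (simp add: base_def)
  then show ?thesis
    by (rule runs_weaken) (use assms(1) le vertex_small[of n] in
      \<open>auto simp: base_def bounded_state_def\<close>)
qed

lemma digits_left_less: "m < 2 ^ k \<Longrightarrow> digits_left (2 ^ k) S m v < 2 ^ k"
  by (induction v) (auto simp: Let_def)

lemma runs_mark_com:
  assumes "base s" "fst s 2 < M"
  shows "runs mark_com s (13 * unit_cost * (n + 1)\<^sup>2)
    (\<lambda>s'. base s' \<and> (\<forall>r\<le>6. fst s' r = fst s r) \<and> arr 0 (mark (fst s 2) (fst s 3) (fst s 4)) s' \<and>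
      (\<forall>i\<ge>n * n + n. snd s' i = snd s i))"
proof -
  let ?S = "in_part (fst s 3) (fst s 4)" and ?mark = "mark (fst s 2) (fst s 3) (fst s 4)"
  let ?d = "digits_left M ?S (fst s 2)"
  let ?P = "\<lambda>i s'. fst s' 7 = i \<and> i \<le> n \<and> base s' \<and> (\<forall>r\<le>6. fst s' r = fst s r) \<and>
    fst s' 10 = ?d i \<and> (\<forall>v<i. snd s' (n * n + v) = ?mark v) \<and> (\<forall>i\<ge>n * n + n. snd s' i = snd s i)"
  have d: "?d i < M" for i using assms(2) digits_left_less unfolding M_def by blast
  have d2: "2 * ?d i < 2 ^ (2 * n + 4)" "?d i < 2 ^ (2 * n + 4)" for i
    using d[of i] M_small by auto
  show ?thesis unfolding mark_com_def
  proof (rule runs_Seq)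
    show "runs (Assign 10 (Reg 2)) s unit_cost (\<lambda>s'. base s' \<and> (\<forall>r\<le>6. fst s' r = fst s r) \<and>
      fst s' 10 = ?d 0 \<and> snd s' = snd s)"
      using assms d2(2)[of 0] by (intro runs_Assign) (auto simp: base_bounded intro!: base_reg)
    fix s1 assume s1: "base s1 \<and> (\<forall>r\<le>6. fst s1 r = fst s r) \<and> fst s1 10 = ?d 0 \<and> snd s1 = snd s"
    let ?If = "If (Times (Minus (Plus key (Const 1)) (Reg 3)) (Minus (Reg 4) key))
       (If (Minus (Plus (Times (Const 2) (Reg 10)) (Const 1)) (Reg 1))
         (Seq (Store (cell 0 7) (Const 0)) (Assign 10 (Minus (Times (Const 2) (Reg 10)) (Reg 1))))
         (Seq (Store (cell 0 7) (Const 2)) (Assign 10 (Times (Const 2) (Reg 10)))))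
       (Store (cell 0 7) (Const 1))"
    show "runs (For 7 (Reg 0) (Seq (Sum 9 8 adj) ?If)) s1
      ((n + 1) * ((5 * unit_cost * (n + 1) + 4 * unit_cost) + 3 * unit_cost))
      (\<lambda>s'. base s' \<and> (\<forall>r\<le>6. fst s' r = fst s r) \<and> arr 0 ?mark s' \<and>
        (\<forall>i\<ge>n * n + n. snd s' i = snd s i))"
    proof (rule runs_weaken[OF runs_For[where P = ?P and N = n]])
      show "fst t 7 = i \<and> val t (Reg 0) = n \<and> bounded_state (2 * n + 4) t" if "?P i t" for i t
        using that by (simp add: base_def)
      show "bounded_state (2 * n + 4) s1" using s1 by (simp add: base_def)
      show "?P 0 ((fst s1)(7 := 0), snd s1)" using s1 by (cases s1) (auto intro!: base_vertex)
      fix i t assume i: "i < n" and P: "?P i t"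
      obtain f m where t: "t = (f, m)" by (cases t)
      from P t have f: "f 7 = i" "base (f, m)" "f 0 = n" "f 1 = M" "f 10 = ?d i" "\<And>r. r \<le> 6 \<Longrightarrow> f r = fst s r"
        "f 3 = fst s 3" "f 4 = fst s 4"
        and m: "\<And>v. v < i \<Longrightarrow> m (n * n + v) = ?mark v" "\<And>i. i \<ge> n * n + n \<Longrightarrow> m i = snd s i"
        by (auto simp: base_def)
      let ?f = "f(8 := n, 9 := deg i)"
      let ?post = "\<lambda>s'. fst s' 7 = i \<and> bounded_state (2 * n + 4) s' \<and>
        ?P (Suc i) ((fst s')(7 := Suc i), snd s')"
      \<comment> \<open>All three branches end in this state, so the invariant is checked for it
        once and each branch only has to identify its result.\<close>
      have post: "?post (?f(10 := ?d (Suc i)), m(n * n + i := ?mark i))" if "base (?f, m)"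
      proof -
        have "base (?f(10 := ?d (Suc i)), m)" by (rule base_reg[OF that _ _ d2(2)]) auto
        then have "base (?f(10 := ?d (Suc i)), m(n * n + i := ?mark i))"
          using mark_le by (intro base_digit) auto
        then show ?thesis using f(1) f(6) m i
          by (auto simp del: digits_left.simps simp: less_Suc_eq intro!: base_vertex base_bounded)
      qed
      show "runs (Seq (Sum 9 8 adj) ?If) t (5 * unit_cost * (n + 1) + 4 * unit_cost) ?post"
      proof (rule runs_Seq)
        show "runs (Sum 9 8 adj) t (5 * unit_cost * (n + 1)) (\<lambda>s'. s' = (?f, m) \<and> base s')"
          using runs_vertex_Sum[of t adj "a i"] t f i le_trans[OF a_le] baseD(3)[OF f(2)]
          by (simp add: deg_def)
        fix s2 assume "s2 = (?f, m) \<and> base s2"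
        then have s2: "s2 = (?f, m)" and b: "base (?f, m)" by auto
        have b': "base (?f, m(n * n + i := k))" if "k \<le> 2" for k
          using b that by (intro base_digit) auto
        \<comment> \<open>The product acts as a conjunction; adding 1 to the key makes the first
          difference nonzero also when the key equals the lower bound.\<close>
        have cond: "val s2 (Times (Minus (Plus key (Const 1)) (Reg 3)) (Minus (Reg 4) key)) \<noteq> 0 \<longleftrightarrow> ?S i"
          using f by (auto simp: s2 in_part_def)
        have "runs ?If s2 (unit_cost + (unit_cost + (unit_cost + unit_cost))) ?post"
        proof (rule runs_If)
          assume "val s2 (Times (Minus (Plus key (Const 1)) (Reg 3)) (Minus (Reg 4) key)) \<noteq> 0"
          with cond have S: "?S i" by simp
          have cond': "val s2 (Minus (Plus (Times (Const 2) (Reg 10)) (Const 1)) (Reg 1)) \<noteq> 0 \<longleftrightarrow>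
            M \<le> 2 * ?d i" using f by (auto simp: s2)
          show "runs (If (Minus (Plus (Times (Const 2) (Reg 10)) (Const 1)) (Reg 1))
           (Seq (Store (cell 0 7) (Const 0)) (Assign 10 (Minus (Times (Const 2) (Reg 10)) (Reg 1))))
           (Seq (Store (cell 0 7) (Const 2)) (Assign 10 (Times (Const 2) (Reg 10)))))
           s2 (unit_cost + (unit_cost + unit_cost)) ?post"
          proof (rule runs_If)
            assume "val s2 (Minus (Plus (Times (Const 2) (Reg 10)) (Const 1)) (Reg 1)) \<noteq> 0"
            with cond' have M: "M \<le> 2 * ?d i" by simp
            with S have new: "?mark i = 0" "?d (Suc i) = 2 * ?d i - M"
              by (simp_all add: mark_def M_def Let_def)
            show "runs (Seq (Store (cell 0 7) (Const 0))
              (Assign 10 (Minus (Times (Const 2) (Reg 10)) (Reg 1)))) s2 (unit_cost + unit_cost) ?post"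
            proof (rule runs_Seq)
              show "runs (Store (cell 0 7) (Const 0)) s2 unit_cost
                (\<lambda>s'. s' = (?f, m(n * n + i := 0)))"
                using b f by (intro runs_Store) (auto simp: s2 base_bounded)
              show "runs (Assign 10 (Minus (Times (Const 2) (Reg 10)) (Reg 1))) s3 unit_cost ?post"
                if "s3 = (?f, m(n * n + i := 0))" for s3
              proof (rule runs_Assign)
                have v: "((fst s3)(10 := val s3 (Minus (Times (Const 2) (Reg 10)) (Reg 1))), snd s3) =
                  (?f(10 := ?d (Suc i)), m(n * n + i := ?mark i))"
                  unfolding new using that f by simp
                show "?post ((fst s3)(10 := val s3 (Minus (Times (Const 2) (Reg 10)) (Reg 1))), snd s3)"
                  unfolding v by (rule post[OF b])
              qed (use that b' in \<open>auto simp: base_bounded\<close>)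
            qed simp
          next
            assume "val s2 (Minus (Plus (Times (Const 2) (Reg 10)) (Const 1)) (Reg 1)) = 0"
            with cond' have M: "\<not> M \<le> 2 * ?d i" by blast
            with S have new: "?mark i = 2" "?d (Suc i) = 2 * ?d i"
              by (simp_all add: mark_def M_def Let_def)
            show "runs (Seq (Store (cell 0 7) (Const 2))
              (Assign 10 (Times (Const 2) (Reg 10)))) s2 (unit_cost + unit_cost) ?post"
            proof (rule runs_Seq)
              show "runs (Store (cell 0 7) (Const 2)) s2 unit_cost
                (\<lambda>s'. s' = (?f, m(n * n + i := 2)))"
                using b f by (intro runs_Store) (auto simp: s2 base_bounded)
              show "runs (Assign 10 (Times (Const 2) (Reg 10))) s3 unit_cost ?post"
                if "s3 = (?f, m(n * n + i := 2))" for s3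
              proof (rule runs_Assign)
                have v: "((fst s3)(10 := val s3 (Times (Const 2) (Reg 10))), snd s3) =
                  (?f(10 := ?d (Suc i)), m(n * n + i := ?mark i))"
                  unfolding new using that f by simp
                show "?post ((fst s3)(10 := val s3 (Times (Const 2) (Reg 10))), snd s3)"
                  unfolding v by (rule post[OF b])
              qed (use that b' in \<open>auto simp: base_bounded\<close>)
            qed simp
          qed (use b s2 in \<open>auto simp: base_bounded\<close>)
        next
          assume "val s2 (Times (Minus (Plus key (Const 1)) (Reg 3)) (Minus (Reg 4) key)) = 0"
          with cond have S: "\<not> ?S i" by blast
          then have new: "?mark i = 1" "?d (Suc i) = ?d i" by (simp_all add: mark_def Let_def)
          have "runs (Store (cell 0 7) (Const 1)) s2 unit_cost ?post"
          proof (rule runs_Store)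
            have v: "(fst s2, (snd s2)(val s2 (cell 0 7) := val s2 (Const 1))) =
              (?f(10 := ?d (Suc i)), m(n * n + i := ?mark i))"
              unfolding new using f by (auto simp: s2)
            show "?post (fst s2, (snd s2)(val s2 (cell 0 7) := val s2 (Const 1)))"
              unfolding v by (rule post[OF b])
          qed (use b s2 in \<open>auto simp: base_bounded\<close>)
          then show "runs (Store (cell 0 7) (Const 1)) s2 (unit_cost + (unit_cost + unit_cost)) ?post"
            by (rule runs_weaken) auto
        qed (use b s2 in \<open>auto simp: base_bounded\<close>)
        then show "runs ?If s2 (4 * unit_cost) ?post" by (rule runs_weaken) auto
      qed simp
    qed (auto simp: arr_def)
  qed (simp add: power2_eq_square algebra_simps)
qed

lemma runs_candidate_com:
  assumes "base s" "arr 0 (mark p q r) s"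
  shows "runs candidate_com s (9 * unit_cost * (n + 1)\<^sup>2)
    (\<lambda>s'. base s' \<and> (\<forall>r\<le>6. fst s' r = fst s r) \<and> arr 1 (candidate p q r (fst s 5)) s' \<and>
      (\<forall>i\<ge>n * n + 2 * n. snd s' i = snd s i))"
proof -
  let ?c = "candidate p q r (fst s 5)"
  let ?P = "\<lambda>i s'. fst s' 7 = i \<and> i \<le> n \<and> base s' \<and> (\<forall>r\<le>6. fst s' r = fst s r) \<and>
    arr 0 (mark p q r) s' \<and> (\<forall>v<i. snd s' (n * n + n + v) = ?c v) \<and>
    (\<forall>i\<ge>n * n + 2 * n. snd s' i = snd s i)"
  let ?sum = "Minus (Plus (Const 1) (Times adj (Load (cell 0 8)))) adj"
  let ?e = "Minus (Const 1) (Minus (Const 1)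
    (Plus (Minus (Const 1) (Load (cell 0 7)))
      (Times (Minus (Const 2) (Load (cell 0 7))) (Minus (Plus key (Const 1)) (Reg 5)))))"
  show ?thesis unfolding candidate_com_def
  proof (rule runs_weaken[OF runs_For[where P = ?P and N = n]])
    show "fst t 7 = i \<and> val t (Reg 0) = n \<and> bounded_state (2 * n + 4) t" if "?P i t" for i t
      using that by (simp add: base_def)
    show "bounded_state (2 * n + 4) s" using assms(1) by (simp add: base_def)
    show "?P 0 ((fst s)(7 := 0), snd s)"
      using assms by (cases s) (auto simp: arr_def intro!: base_vertex)
    fix i t assume i: "i < n" and P: "?P i t"
    obtain f m where t: "t = (f, m)" by (cases t)
    from P t have f: "f 7 = i" "base (f, m)" "f 0 = n" "f 5 = fst s 5" "\<And>r. r \<le> 6 \<Longrightarrow> f r = fst s r"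
      and m: "\<And>v. v < n \<Longrightarrow> m (n * n + v) = mark p q r v"
        "\<And>v. v < i \<Longrightarrow> m (n * n + n + v) = ?c v" "\<And>i. i \<ge> n * n + 2 * n \<Longrightarrow> m i = snd s i"
      by (auto simp: base_def arr_def)
    let ?f = "f(8 := n, 9 := score p q r i)"
    let ?post = "\<lambda>s'. fst s' 7 = i \<and> bounded_state (2 * n + 4) s' \<and>
      ?P (Suc i) ((fst s')(7 := Suc i), snd s')"
    show "runs (Seq (Sum 9 8 ?sum) (Store (cell 1 7) ?e)) t
      (5 * unit_cost * (n + 1) + unit_cost) ?post"
    proof (rule runs_Seq)
      have "1 + a i u * mark p q r u - a i u \<le> 2" for u
        using a_le[of i u] mark_le[of p q r u] by (cases "a i u") auto
      then show "runs (Sum 9 8 ?sum) t (5 * unit_cost * (n + 1)) (\<lambda>s'. s' = (?f, m) \<and> base s')"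
        using runs_vertex_Sum[of t ?sum "\<lambda>u. 1 + a i u * mark p q r u - a i u"]
          t f i m(1) baseD(3)[OF f(2)] by (simp add: score_def)
      fix s2 assume "s2 = (?f, m) \<and> base s2"
      then have s2: "s2 = (?f, m)" and b: "base (?f, m)" by auto
      show "runs (Store (cell 1 7) ?e) s2 unit_cost ?post"
      proof (rule runs_Store)
        have v: "(fst s2, (snd s2)(val s2 (cell 1 7) := val s2 ?e)) = (?f, m(n * n + n + i := ?c i))"
          using f m(1)[OF i] by (simp add: s2 candidate_def)
        have b': "base (?f, m(n * n + n + i := ?c i))"
          using candidate_le[of p q r "fst s 5" i] by (intro base_digit[OF b]) auto
        show "?post (fst s2, (snd s2)(val s2 (cell 1 7) := val s2 ?e))"
          unfolding v using b' f(1) f(5) i m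
          by (auto simp: less_Suc_eq arr_def intro!: base_vertex base_bounded)
      qed (use b s2 in \<open>auto simp: base_bounded\<close>)
    qed simp
  qed (auto simp: arr_def power2_eq_square algebra_simps)
qed

lemma partial_cut_value_le:
  assumes "\<And>v. x v \<le> 1" "i \<le> n"
  shows "(\<Sum>u<i. x u * (\<Sum>v<n. a u v * (1 - x v))) \<le> n * n"
proof -
  have inner: "(\<Sum>v<n. a u v * (1 - x v)) \<le> n" for u
  proof -
    have "a u v * (1 - x v) \<le> 1" for v using a_le[of u v] by (cases "a u v") auto
    then show ?thesis using sum_bounded_above[of "{..<n}" "\<lambda>v. a u v * (1 - x v)" 1] by simp
  qed
  have "x u * (\<Sum>v<n. a u v * (1 - x v)) \<le> n" for u
    using mult_le_mono[OF assms(1)[of u] inner[of u]] by simp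
  then have "(\<Sum>u<i. x u * (\<Sum>v<n. a u v * (1 - x v))) \<le> i * n"
    using sum_bounded_above[of "{..<i}" "\<lambda>u. x u * (\<Sum>v<n. a u v * (1 - x v))" n] by simp
  also have "\<dots> \<le> n * n" using assms(2) by simp
  finally show ?thesis .
qed

lemma runs_value_com:
  assumes "base s" "arr 1 x s" "\<And>v. x v \<le> 1"
  shows "runs value_com s (10 * unit_cost * (n + 1)\<^sup>2)
    (\<lambda>s'. base s' \<and> (\<forall>r\<le>6. fst s' r = fst s r) \<and> snd s' = snd s \<and> fst s' 11 = cut_value x)"
proof -
  let ?g = "\<lambda>u. \<Sum>v<n. a u v * (1 - x v)"
  let ?w = "\<lambda>i. \<Sum>u<i. x u * ?g u"
  let ?P = "\<lambda>i s'. fst s' 7 = i \<and> i \<le> n \<and> base s' \<and> (\<forall>r\<le>6. fst s' r = fst s r) \<and>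
    snd s' = snd s \<and> fst s' 11 = ?w i"
  let ?sum = "Times adj (Minus (Const 1) (Load (cell 1 8)))"
  let ?e = "Plus (Reg 11) (Times (Load (cell 1 7)) (Reg 9))"
  have w: "?w i < 2 ^ (2 * n + 4)" if "i \<le> n" for i
    by (intro small order_trans[OF partial_cut_value_le[of x i, OF assms(3) that]]) (simp add: algebra_simps)
  show ?thesis unfolding value_com_def
  proof (rule runs_Seq)
    show "runs (Assign 11 (Const 0)) s unit_cost (\<lambda>s'. base s' \<and> (\<forall>r\<le>6. fst s' r = fst s r) \<and>
      snd s' = snd s \<and> fst s' 11 = ?w 0)"
      using assms(1) by (cases s) (intro runs_Assign; auto simp: base_bounded intro!: base_vertex)
    fix s1 assume s1: "base s1 \<and> (\<forall>r\<le>6. fst s1 r = fst s r) \<and> snd s1 = snd s \<and> fst s1 11 = ?w 0"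
    show "runs (For 7 (Reg 0) (Seq (Sum 9 8 ?sum) (Assign 11 ?e))) s1
      ((n + 1) * ((5 * unit_cost * (n + 1) + unit_cost) + 3 * unit_cost))
      (\<lambda>s'. base s' \<and> (\<forall>r\<le>6. fst s' r = fst s r) \<and> snd s' = snd s \<and> fst s' 11 = cut_value x)"
    proof (rule runs_weaken[OF runs_For[where P = ?P and N = n]])
      show "fst t 7 = i \<and> val t (Reg 0) = n \<and> bounded_state (2 * n + 4) t" if "?P i t" for i t
        using that by (simp add: base_def)
      show "bounded_state (2 * n + 4) s1" using s1 by (simp add: base_def)
      show "?P 0 ((fst s1)(7 := 0), snd s1)" using s1 by (cases s1) (auto intro!: base_vertex)
      fix i t assume i: "i < n" and P: "?P i t"
      obtain f m where t: "t = (f, m)" by (cases t)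
      from P t have f: "f 7 = i" "base (f, m)" "f 0 = n" "f 11 = ?w i" "\<And>r. r \<le> 6 \<Longrightarrow> f r = fst s r"
        and m: "m = snd s" "\<And>v. v < n \<Longrightarrow> m (n * n + n + v) = x v"
        using assms(2) by (auto simp: base_def arr_def)
      let ?f = "f(8 := n, 9 := ?g i)"
      let ?post = "\<lambda>s'. fst s' 7 = i \<and> bounded_state (2 * n + 4) s' \<and>
        ?P (Suc i) ((fst s')(7 := Suc i), snd s')"
      show "runs (Seq (Sum 9 8 ?sum) (Assign 11 ?e)) t
        (5 * unit_cost * (n + 1) + unit_cost) ?post"
      proof (rule runs_Seq)
        have "a i u * (1 - x u) \<le> 2" for u
          using a_le[of i u] by (cases "a i u") auto
        then show "runs (Sum 9 8 ?sum) t (5 * unit_cost * (n + 1)) (\<lambda>s'. s' = (?f, m) \<and> base s')"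
          using runs_vertex_Sum[of t ?sum "\<lambda>u. a i u * (1 - x u)"]
            t f(1-3) i m(2) baseD(3)[OF f(2)] by simp
        fix s2 assume "s2 = (?f, m) \<and> base s2"
        then have s2: "s2 = (?f, m)" and b: "base (?f, m)" by auto
        show "runs (Assign 11 ?e) s2 unit_cost ?post"
        proof (rule runs_Assign)
          have v: "((fst s2)(11 := val s2 ?e), snd s2) = (?f(11 := ?w (Suc i)), m)"
            using f m(2)[OF i] by (simp add: s2)
          have b': "base (?f(11 := ?w (Suc i)), m)"
            using i w[of "Suc i"] by (intro base_reg[OF b]) auto
          show "?post ((fst s2)(11 := val s2 ?e), snd s2)"
            unfolding v using b' f(1) f(5) i m(1)
            by (auto simp del: sum.lessThan_Suc intro!: base_vertex base_bounded)
        qed (use b s2 in \<open>auto simp: base_bounded\<close>)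
      qed simp
    qed (auto simp: cut_value_def)
  qed (simp add: power2_eq_square algebra_simps)
qed

text \<open>Only soundness of the record: register 6 is the value of the stored cut. Optimality is
  accumulated in the postconditions of the loops.\<close>

definition invar :: "state \<Rightarrow> bool" where
  "invar s \<longleftrightarrow> base s \<and> (\<exists>x. (\<forall>v. x v \<le> 1) \<and> arr 2 x s \<and> fst s 6 = cut_value x)"

lemma runs_update_com:
  assumes "invar s" "arr 1 x s" "\<And>v. x v \<le> 1" "fst s 11 = cut_value x"
  shows "runs update_com s (6 * unit_cost * (n + 1)\<^sup>2)
    (\<lambda>s'. invar s' \<and> (\<forall>r\<le>5. fst s' r = fst s r) \<and> fst s 6 \<le> fst s' 6 \<and> cut_value x \<le> fst s' 6)"
    (is "runs _ _ _ ?Q")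
proof -
  let ?P = "\<lambda>i s'. fst s' 7 = i \<and> i \<le> n \<and> base s' \<and> (\<forall>r\<le>5. fst s' r = fst s r) \<and> arr 1 x s' \<and>
    fst s' 6 = cut_value x \<and> (\<forall>v<i. snd s' (n * n + 2 * n + v) = x v)"
  have base: "base s" using assms(1) by (simp add: invar_def)
  have w: "cut_value x < 2 ^ (2 * n + 4)"
    unfolding cut_value_def
    by (intro small order_trans[OF partial_cut_value_le[of x n, OF assms(3)]]) (simp_all add: algebra_simps)
  have "runs update_com s (unit_cost + (unit_cost + (n + 1) * (unit_cost + 3 * unit_cost))) ?Q"
    unfolding update_com_def
  proof (rule runs_If)
    assume better: "val s (Minus (Reg 11) (Reg 6)) \<noteq> 0"
    show "runs (Seq (Assign 6 (Reg 11)) (For 7 (Reg 0) (Store (cell 2 7) (Load (cell 1 7))))) s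
      (unit_cost + (n + 1) * (unit_cost + 3 * unit_cost)) ?Q"
    proof (rule runs_Seq)
      show "runs (Assign 6 (Reg 11)) s unit_cost (\<lambda>s'. base s' \<and> (\<forall>r\<le>5. fst s' r = fst s r) \<and>
        arr 1 x s' \<and> fst s' 6 = cut_value x)"
        using assms base w by (cases s) (intro runs_Assign; auto simp: base_bounded arr_def intro!: base_reg)
      fix s1 assume s1: "base s1 \<and> (\<forall>r\<le>5. fst s1 r = fst s r) \<and> arr 1 x s1 \<and> fst s1 6 = cut_value x"
      show "runs (For 7 (Reg 0) (Store (cell 2 7) (Load (cell 1 7)))) s1
        ((n + 1) * (unit_cost + 3 * unit_cost)) ?Q"
      proof (rule runs_weaken[OF runs_For[where P = ?P and N = n]])
        show "fst t 7 = i \<and> val t (Reg 0) = n \<and> bounded_state (2 * n + 4) t" if "?P i t" for i t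
          using that by (simp add: base_def)
        show "bounded_state (2 * n + 4) s1" using s1 by (simp add: base_def)
        show "?P 0 ((fst s1)(7 := 0), snd s1)"
          using s1 by (cases s1) (auto simp: arr_def intro!: base_vertex)
        fix i t assume i: "i < n" and P: "?P i t"
        obtain f m where t: "t = (f, m)" by (cases t)
        from P t have f: "f 7 = i" "base (f, m)" "f 0 = n" "f 6 = cut_value x" "\<And>r. r \<le> 5 \<Longrightarrow> f r = fst s r"
          and m: "\<And>v. v < n \<Longrightarrow> m (n * n + n + v) = x v" "\<And>v. v < i \<Longrightarrow> m (n * n + 2 * n + v) = x v"
          by (auto simp: base_def arr_def)
        let ?post = "\<lambda>s'. fst s' 7 = i \<and> bounded_state (2 * n + 4) s' \<and>
          ?P (Suc i) ((fst s')(7 := Suc i), snd s')"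
        show "runs (Store (cell 2 7) (Load (cell 1 7))) t unit_cost ?post"
        proof (rule runs_Store)
          have v: "(fst t, (snd t)(val t (cell 2 7) := val t (Load (cell 1 7)))) =
            (f, m(n * n + 2 * n + i := x i))"
            using f m(1)[OF i] by (simp add: t)
          have b': "base (f, m(n * n + 2 * n + i := x i))"
            using assms(3)[of i] by (intro base_digit[OF f(2)]) auto
          show "?post (fst t, (snd t)(val t (cell 2 7) := val t (Load (cell 1 7))))"
            unfolding v using b' f(1) f(4) f(5) i m
            by (auto simp: less_Suc_eq arr_def intro!: base_vertex base_bounded)
        qed (use f t in \<open>auto simp: base_bounded\<close>)
      next
        show "?Q s'" if "?P n s'" for s'
          using that better assms(3,4) by (auto simp: invar_def arr_def)
      qed auto
    qed simp
  next
    assume "val s (Minus (Reg 11) (Reg 6)) = 0"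
    then have "runs Skip s unit_cost ?Q" using assms by (intro runs_Skip) auto
    then show "runs Skip s (unit_cost + (n + 1) * (unit_cost + 3 * unit_cost)) ?Q"
      by (rule runs_weaken) auto
  qed (use base in \<open>auto simp: base_bounded\<close>)
  then show ?thesis by (rule runs_weaken) (auto simp: power2_eq_square algebra_simps)
qed

lemma runs_try_com:
  assumes "invar s" "fst s 2 < M"
  shows "runs try_com s (38 * unit_cost * (n + 1)\<^sup>2)
    (\<lambda>s'. invar s' \<and> (\<forall>r\<le>5. fst s' r = fst s r) \<and> fst s 6 \<le> fst s' 6 \<and>
      cut_value (candidate (fst s 2) (fst s 3) (fst s 4) (fst s 5)) \<le> fst s' 6)"
proof -
  let ?c = "candidate (fst s 2) (fst s 3) (fst s 4) (fst s 5)"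
  obtain x where x: "\<And>v. x v \<le> 1" "arr 2 x s" "fst s 6 = cut_value x" and base: "base s"
    using assms(1) by (auto simp: invar_def)
  \<comment> \<open>The cells from n * n + 2 * n on store the best cut so far. Everything before
    \<open>update_com\<close> leaves them alone, so \<open>invar\<close> still holds when
    \<open>update_com\<close> starts.\<close>
  let ?R = "\<lambda>s'. base s' \<and> (\<forall>r\<le>6. fst s' r = fst s r) \<and> (\<forall>i\<ge>n * n + 2 * n. snd s' i = snd s i)"
  show ?thesis unfolding try_com_def
  proof (rule runs_Seq)
    show "runs mark_com s (13 * unit_cost * (n + 1)\<^sup>2)
      (\<lambda>s'. ?R s' \<and> arr 0 (mark (fst s 2) (fst s 3) (fst s 4)) s')"
      by (rule runs_weaken[OF runs_mark_com[OF base assms(2)]]) auto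
    fix s1 assume s1: "?R s1 \<and> arr 0 (mark (fst s 2) (fst s 3) (fst s 4)) s1"
    show "runs (Seq candidate_com (Seq value_com update_com)) s1 (25 * unit_cost * (n + 1)\<^sup>2)
      (\<lambda>s'. invar s' \<and> (\<forall>r\<le>5. fst s' r = fst s r) \<and> fst s 6 \<le> fst s' 6 \<and> cut_value ?c \<le> fst s' 6)"
    proof (rule runs_Seq)
      have c: "fst s1 5 = fst s 5" using s1 by simp
      show "runs candidate_com s1 (9 * unit_cost * (n + 1)\<^sup>2) (\<lambda>s'. ?R s' \<and> arr 1 ?c s')"
        by (rule runs_weaken[OF runs_candidate_com]) (use s1 c in auto)
      fix s2 assume s2: "?R s2 \<and> arr 1 ?c s2"
      show "runs (Seq value_com update_com) s2 (16 * unit_cost * (n + 1)\<^sup>2)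
        (\<lambda>s'. invar s' \<and> (\<forall>r\<le>5. fst s' r = fst s r) \<and> fst s 6 \<le> fst s' 6 \<and> cut_value ?c \<le> fst s' 6)"
      proof (rule runs_Seq)
        show "runs value_com s2 (10 * unit_cost * (n + 1)\<^sup>2)
          (\<lambda>s'. ?R s' \<and> arr 1 ?c s' \<and> fst s' 11 = cut_value ?c)"
          by (rule runs_weaken[OF runs_value_com[of s2 ?c]])
            (use s2 candidate_le in \<open>auto simp: arr_def\<close>)
        fix s3 assume s3: "?R s3 \<and> arr 1 ?c s3 \<and> fst s3 11 = cut_value ?c"
        then have "invar s3" using x by (auto simp: invar_def arr_def)
        then show "runs update_com s3 (6 * unit_cost * (n + 1)\<^sup>2)
          (\<lambda>s'. invar s' \<and> (\<forall>r\<le>5. fst s' r = fst s r) \<and> fst s 6 \<le> fst s' 6 \<and> cut_value ?c \<le> fst s' 6)"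
          by (intro runs_weaken[OF runs_update_com[of s3 ?c]]) (use s3 candidate_le in auto)
      qed simp
    qed simp
  qed simp
qed

section \<open>The search over all parameters\<close>

text \<open>\<open>R\<close> is a precondition on the outer parameters; \<open>Q\<close> is meant to say that the best value found so
  far dominates the candidates belonging to the current parameters.\<close>

lemma runs_For_search:
  assumes x: "x \<in> {2..5}" and size: "expr_size e \<le> 48"
    and e: "\<And>s. base s \<Longrightarrow> val s e = N" and N: "N < 2 ^ (2 * n + 4)"
    and R: "\<And>f g. \<forall>r<x. f r = g r \<Longrightarrow> R f \<Longrightarrow> R g"
    and Q: "\<And>f g b b'. \<forall>r\<le>x. f r = g r \<Longrightarrow> b \<le> b' \<Longrightarrow> Q f b \<Longrightarrow> Q g b'"
    and body: "\<And>s. invar s \<Longrightarrow> R (fst s) \<Longrightarrow> fst s x < N \<Longrightarrow> runs c s T (\<lambda>s'. invar s' \<and>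
      (\<forall>r\<le>x. fst s' r = fst s r) \<and> fst s 6 \<le> fst s' 6 \<and> Q (fst s) (fst s' 6))"
    and s: "invar s" "R (fst s)"
  shows "runs (For x e c) s ((N + 1) * (T + 3 * unit_cost)) (\<lambda>s'. invar s' \<and>
    (\<forall>r<x. fst s' r = fst s r) \<and> fst s 6 \<le> fst s' 6 \<and> (\<forall>i<N. Q ((fst s)(x := i)) (fst s' 6)))"
proof -
  let ?P = "\<lambda>i s'. invar s' \<and> fst s' x = i \<and> i \<le> N \<and> (\<forall>r<x. fst s' r = fst s r) \<and>
    fst s 6 \<le> fst s' 6 \<and> (\<forall>j<i. Q ((fst s)(x := j)) (fst s' 6))"
  have inv_upd: "invar ((fst t)(x := i), snd t)" if "invar t" "i \<le> N" for t i
    using that x N by (cases t) (auto simp: invar_def arr_def intro!: base_reg)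
  show ?thesis
  proof (rule runs_weaken[OF runs_For[where P = ?P and N = N]])
    show "fst t x = i \<and> val t e = N \<and> bounded_state (2 * n + 4) t" if "?P i t" for i t
      using that e by (auto simp: invar_def base_bounded)
    show "bounded_state (2 * n + 4) s" using s by (auto simp: invar_def base_bounded)
    show "?P 0 ((fst s)(x := 0), snd s)" using inv_upd[OF s(1), of 0] x by auto
    fix i t assume i: "i < N" and P: "?P i t"
    then have "R (fst t)" using R[of "fst s" "fst t"] s(2) by simp
    with P i have "runs c t T (\<lambda>s'. invar s' \<and>
      (\<forall>r\<le>x. fst s' r = fst t r) \<and> fst t 6 \<le> fst s' 6 \<and> Q (fst t) (fst s' 6))"
      by (intro body) auto
    then show "runs c t T (\<lambda>s'. fst s' x = i \<and> bounded_state (2 * n + 4) s' \<and>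
      ?P (Suc i) ((fst s')(x := Suc i), snd s'))"
    proof (rule runs_weaken)
      fix s' assume s': "invar s' \<and> (\<forall>r\<le>x. fst s' r = fst t r) \<and> fst t 6 \<le> fst s' 6 \<and> Q (fst t) (fst s' 6)"
      have "Q ((fst s)(x := j)) (fst s' 6)" if "j < Suc i" for j
      proof (cases "j = i")
        case True
        show ?thesis by (rule Q[of "fst t" _ "fst s' 6"]) (use True P s' in auto)
      next
        case False
        \<comment> \<open>Parameters treated earlier stay dominated because register 6 never
          decreases.\<close>
        show ?thesis by (rule Q[of "(fst s)(x := j)" _ "fst t 6"]) (use False that P s' in auto)
      qed
      then show "fst s' x = i \<and> bounded_state (2 * n + 4) s' \<and> ?P (Suc i) ((fst s')(x := Suc i), snd s')"
        using s' P i x inv_upd[of s' "Suc i"] by (auto simp: invar_def base_bounded)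
    qed simp
  qed (use size in auto)
qed

lemma val_limit: "base s \<Longrightarrow> val s limit = 2 * n * n + n + 1"
  by (simp add: limit_def baseD algebra_simps)

text \<open>Each loop turns its own parameter in the \<open>Q\<close> of its body into a universally
  quantified one. The mask loop supplies \<open>f 2 < M\<close>, which keeps the digit register
  below \<open>M\<close>, so its own precondition is trivial.\<close>

lemma runs_search_com:
  assumes "invar s"
  shows "runs search_com s (720 * M * unit_cost * (n + 1) ^ 8)
    (\<lambda>s'. invar s' \<and> (\<forall>m<M. \<forall>p\<le>2 * n * n + n. \<forall>q\<le>2 * n * n + n. \<forall>\<theta>\<le>2 * n * n + n.
      cut_value (candidate m p q \<theta>) \<le> fst s' 6))"
proof -
  let ?N = "2 * n * n + n + 1" and ?U = unit_cost
  let ?T3 = "38 * ?U * (n + 1)\<^sup>2"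
  let ?T2 = "(?N + 1) * (?T3 + 3 * ?U)"
  let ?T1 = "(?N + 1) * (?T2 + 3 * ?U)"
  let ?T0 = "(?N + 1) * (?T1 + 3 * ?U)"
  let ?R = "\<lambda>f :: nat \<Rightarrow> nat. f 2 < M"
  let ?Q3 = "\<lambda>f b. cut_value (candidate (f 2) (f 3) (f 4) (f 5)) \<le> b"
  let ?Q2 = "\<lambda>f b. \<forall>\<theta><?N. cut_value (candidate (f 2) (f 3) (f 4) \<theta>) \<le> b"
  let ?Q1 = "\<lambda>f b. \<forall>q<?N. \<forall>\<theta><?N. cut_value (candidate (f 2) (f 3) q \<theta>) \<le> b"
  let ?Q0 = "\<lambda>f b. \<forall>p<?N. \<forall>q<?N. \<forall>\<theta><?N. cut_value (candidate (f 2) p q \<theta>) \<le> b"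
  let ?c3 = try_com
  let ?c2 = "For 5 limit ?c3"
  let ?c1 = "For 4 limit ?c2"
  let ?c0 = "For 3 limit ?c1"
  have size: "expr_size limit \<le> 48" by (simp add: limit_def)
  have N: "?N < 2 ^ (2 * n + 4)" by (rule small) (simp add: algebra_simps)
  have 2: "runs ?c2 s ?T2 (\<lambda>s'. invar s' \<and> (\<forall>r<5. fst s' r = fst s r) \<and> fst s 6 \<le> fst s' 6 \<and>
      (\<forall>i<?N. ?Q3 ((fst s)(5 := i)) (fst s' 6)))" if "invar s" "?R (fst s)" for s
  proof (rule runs_For_search[where R = ?R and Q = ?Q3, OF _ size val_limit N])
    show "?Q3 g b'" if "\<forall>r\<le>5. f r = g r" "b \<le> b'" "?Q3 f b" for f g :: "nat \<Rightarrow> nat" and b b'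
      using that by simp
    show "runs try_com s ?T3 (\<lambda>s'. invar s' \<and> (\<forall>r\<le>5. fst s' r = fst s r) \<and> fst s 6 \<le> fst s' 6 \<and>
      ?Q3 (fst s) (fst s' 6))" if "invar s" "?R (fst s)" for s
      by (rule runs_try_com[OF that])
  qed (use that in simp_all)
  have 1: "runs ?c1 s ?T1 (\<lambda>s'. invar s' \<and> (\<forall>r<4. fst s' r = fst s r) \<and> fst s 6 \<le> fst s' 6 \<and>
      (\<forall>i<?N. ?Q2 ((fst s)(4 := i)) (fst s' 6)))" if "invar s" "?R (fst s)" for s
  proof (rule runs_For_search[where R = ?R and Q = ?Q2, OF _ size val_limit N])
    show "?Q2 g b'" if "\<forall>r\<le>4. f r = g r" "b \<le> b'" "?Q2 f b" for f g :: "nat \<Rightarrow> nat" and b b'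
    proof -
      have eq: "g 2 = f 2" "g 3 = f 3" "g 4 = f 4" using that(1) by simp_all
      from that(3) show ?thesis unfolding eq by (blast intro: le_trans[OF _ that(2)])
    qed
    show "runs ?c2 s ?T2 (\<lambda>s'. invar s' \<and> (\<forall>r\<le>4. fst s' r = fst s r) \<and> fst s 6 \<le> fst s' 6 \<and>
      ?Q2 (fst s) (fst s' 6))" if "invar s" "?R (fst s)" for s
      by (rule runs_weaken[OF 2[OF that]]) simp_all
  qed (use that in simp_all)
  have 0: "runs ?c0 s ?T0 (\<lambda>s'. invar s' \<and> (\<forall>r<3. fst s' r = fst s r) \<and> fst s 6 \<le> fst s' 6 \<and>
      (\<forall>i<?N. ?Q1 ((fst s)(3 := i)) (fst s' 6)))" if "invar s" "?R (fst s)" for s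
  proof (rule runs_For_search[where R = ?R and Q = ?Q1, OF _ size val_limit N])
    show "?Q1 g b'" if "\<forall>r\<le>3. f r = g r" "b \<le> b'" "?Q1 f b" for f g :: "nat \<Rightarrow> nat" and b b'
    proof -
      have eq: "g 2 = f 2" "g 3 = f 3" using that(1) by simp_all
      from that(3) show ?thesis unfolding eq by (blast intro: le_trans[OF _ that(2)])
    qed
    show "runs ?c1 s ?T1 (\<lambda>s'. invar s' \<and> (\<forall>r\<le>3. fst s' r = fst s r) \<and> fst s 6 \<le> fst s' 6 \<and>
      ?Q1 (fst s) (fst s' 6))" if "invar s" "?R (fst s)" for s
      by (rule runs_weaken[OF 1[OF that]]) simp_all
  qed (use that in simp_all)
  have "runs search_com s ((M + 1) * (?T0 + 3 * ?U)) (\<lambda>s'. invar s' \<and> (\<forall>r<2. fst s' r = fst s r) \<and>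
    fst s 6 \<le> fst s' 6 \<and> (\<forall>m<M. ?Q0 ((fst s)(2 := m)) (fst s' 6)))"
    unfolding search_com_def
  proof (rule runs_For_search[where R = "\<lambda>_. True"])
    show "?Q0 g b'" if "\<forall>r\<le>2. f r = g r" "b \<le> b'" "?Q0 f b" for f g :: "nat \<Rightarrow> nat" and b b'
    proof -
      have eq: "g 2 = f 2" using that(1) by simp_all
      from that(3) show ?thesis unfolding eq by (blast intro: le_trans[OF _ that(2)])
    qed
    show "runs ?c0 s ?T0 (\<lambda>s'. invar s' \<and> (\<forall>r\<le>2. fst s' r = fst s r) \<and> fst s 6 \<le> fst s' 6 \<and>
      ?Q0 (fst s) (fst s' 6))" if "invar s" "fst s 2 < M" for s
      by (rule runs_weaken[OF 0[OF that]]) simp_all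
    show "M < 2 ^ (2 * n + 4)" by (rule M_small) simp
    show "val s (Reg 1) = M" if "base s" for s using baseD(2)[OF that] by simp
  qed (use assms in simp_all)
  moreover have "(M + 1) * (?T0 + 3 * ?U) \<le> 720 * M * ?U * (n + 1) ^ 8"
  proof -
    define k where "k = n + 1"
    have N: "?N + 1 \<le> 2 * k\<^sup>2" by (simp add: k_def power2_eq_square algebra_simps)
    have pad: "?U \<le> ?U * k ^ j" for j by (simp add: k_def)
    have step: "(?N + 1) * (T + 3 * ?U) \<le> (2 * c + 6) * (?U * k ^ (j + 2))"
      if "T \<le> c * (?U * k ^ j)" for T c j
    proof -
      have "(?N + 1) * (T + 3 * ?U) \<le> (2 * k\<^sup>2) * (c * (?U * k ^ j) + 3 * (?U * k ^ j))"
        by (intro mult_le_mono[OF N] add_le_mono that mult_le_mono2 pad)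
      also have "\<dots> = (2 * c + 6) * (?U * k ^ (j + 2))"
        by (simp add: power_add algebra_simps power2_eq_square)
      finally show ?thesis .
    qed
    have "?T3 \<le> 38 * (?U * k ^ 2)" by (simp add: k_def)
    \<comment> \<open>Three loops take 38 to 82, 170 and 346 under c -> 2 * c + 6, and the exponent
      from 2 to 8.\<close>
    from step[OF step[OF step[OF this]]] have T0: "?T0 \<le> 346 * (?U * k ^ 8)" by simp
    have M: "M + 1 \<le> 2 * M" by (simp add: M_def)
    \<comment> \<open>The exact factor is 2 * (346 + 3) = 698, rounded up to 720.\<close>
    have "(M + 1) * (?T0 + 3 * ?U) \<le> (2 * M) * (346 * (?U * k ^ 8) + 3 * (?U * k ^ 8))"
      by (rule mult_le_mono[OF M add_le_mono[OF T0 mult_le_mono2[OF pad]]])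
    also have "\<dots> \<le> 720 * M * ?U * k ^ 8" by (simp add: algebra_simps)
    finally show ?thesis unfolding k_def .
  qed
  ultimately show ?thesis
    by (rule runs_weaken) (auto simp: less_Suc_eq_le)
qed

lemma runs_init_com:
  assumes "fst s = (\<lambda>_. 0)(0 := n)" "\<And>u v. u < n \<Longrightarrow> v < n \<Longrightarrow> snd s (u * n + v) = a u v"
    "\<And>i. i \<ge> n * n \<Longrightarrow> snd s i = 0" "\<And>i. snd s i \<le> 1"
  shows "runs init_com s (6 * unit_cost * (n + 1)) invar"
proof -
  let ?P = "\<lambda>i s'. i \<le> n \<and> s' = ((fst s)(1 := 2 ^ min i (n div 2), 7 := i), snd s)"
  have two: "2 ^ k < (2::nat) ^ (2 * n + 4)" if "k \<le> n div 2" for k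
    by (rule power_strict_increasing) (use that in auto)
  have cells: "snd s i < 2 ^ (2 * n + 4)" for i
    by (rule le_less_trans[OF assms(4)]) (rule small, simp)
  have bounded: "bounded_state (2 * n + 4) ((fst s)(1 := 2 ^ k, 7 := i), snd s)"
    if "k \<le> n div 2" "i \<le> n" for i k
    unfolding bounded_state_def
    using two[OF that(1)] vertex_small[OF that(2)] vertex_small[of n] cells by (auto simp: assms(1))
  have bounded0: "bounded_state (2 * n + 4) s"
    unfolding bounded_state_def
    using vertex_small[of n] cells by (auto simp: assms(1))
  show ?thesis unfolding init_com_def
  proof (rule runs_Seq)
    show "runs (Assign 1 (Const 1)) s unit_cost (\<lambda>s'. s' = ((fst s)(1 := 1), snd s))"
      by (rule runs_Assign) (use bounded0 in auto)
    fix s1 assume s1: "s1 = ((fst s)(1 := 1), snd s)"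
    show "runs (For 7 (Reg 0) (If (Minus (Reg 0) (Plus (Times (Const 2) (Reg 7)) (Const 1)))
       (Assign 1 (Times (Const 2) (Reg 1))) Skip)) s1
       ((n + 1) * ((unit_cost + unit_cost) + 3 * unit_cost)) invar"
    proof (rule runs_weaken[OF runs_For[where P = ?P and N = n]])
      show "fst t 7 = i \<and> val t (Reg 0) = n \<and> bounded_state (2 * n + 4) t" if "?P i t" for i t
        using that assms(1) bounded[of "min i (n div 2)" i] by auto
      show "bounded_state (2 * n + 4) s1" using bounded_state_reg[OF bounded0 small[of 1], of 1] s1
        by simp
      show "?P 0 ((fst s1)(7 := 0), snd s1)" by (simp add: s1)
      fix i t assume i: "i < n" and P: "?P i t"
      let ?post = "\<lambda>s'. fst s' 7 = i \<and> bounded_state (2 * n + 4) s' \<and>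
        ?P (Suc i) ((fst s')(7 := Suc i), snd s')"
      have post: "?post ((fst s)(1 := 2 ^ min (Suc i) (n div 2), 7 := i), snd s)"
        using i bounded[of "min (Suc i) (n div 2)" i] by (simp add: fun_upd_twist)
      show "runs (If (Minus (Reg 0) (Plus (Times (Const 2) (Reg 7)) (Const 1)))
         (Assign 1 (Times (Const 2) (Reg 1))) Skip) t (unit_cost + unit_cost) ?post"
      proof (rule runs_If)
        show b: "bounded_state (2 * n + 4) t" using P bounded[of "min i (n div 2)" i] by auto
        assume "val t (Minus (Reg 0) (Plus (Times (Const 2) (Reg 7)) (Const 1))) \<noteq> 0"
        then have "2 * i + 1 < n" using P assms(1) by simp
        then have "min (Suc i) (n div 2) = Suc (min i (n div 2))" by auto
        then have p: "(2::nat) ^ min (Suc i) (n div 2) = 2 * 2 ^ min i (n div 2)" by simp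
        from P have t: "t = ((fst s)(1 := 2 ^ min i (n div 2), 7 := i), snd s)" by blast
        have v: "((fst t)(1 := val t (Times (Const 2) (Reg 1))), snd t) =
          ((fst s)(1 := 2 ^ min (Suc i) (n div 2), 7 := i), snd s)"
          unfolding p t by (simp add: fun_eq_iff)
        show "runs (Assign 1 (Times (Const 2) (Reg 1))) t unit_cost ?post"
        proof (rule runs_Assign)
          show "?post ((fst t)(1 := val t (Times (Const 2) (Reg 1))), snd t)"
            unfolding v by (rule post)
        qed (use b in auto)
      next
        assume "val t (Minus (Reg 0) (Plus (Times (Const 2) (Reg 7)) (Const 1))) = 0"
        then have "n \<le> 2 * i + 1" using P assms(1) by simp
        then have "min (Suc i) (n div 2) = min i (n div 2)" by auto
        with P have v: "t = ((fst s)(1 := 2 ^ min (Suc i) (n div 2), 7 := i), snd s)" by simp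
        show "runs Skip t unit_cost ?post" unfolding v by (rule runs_Skip) (rule post)
      qed simp
    next
      fix s' assume P: "?P n s'"
      have "min n (n div 2) = n div 2" by (rule min_absorb2) simp
      with P have s': "s' = ((fst s)(1 := M, 7 := n), snd s)" by (simp only: M_def)
      have "base s'" using bounded[of "n div 2" n] assms(1,2) by (simp add: base_def s' M_def)
      \<comment> \<open>The search starts from the empty cut: the zeros behind the matrix already
        store it, and register 6 already holds its value 0.\<close>
      moreover have "arr 2 (\<lambda>_. 0) s'" using assms(3) by (simp add: arr_def s')
      moreover have "fst s' 6 = cut_value (\<lambda>_. 0)" by (simp add: s' assms(1) cut_value_def)
      ultimately show "invar s'"
        unfolding invar_def by (intro conjI exI[of _ "\<lambda>_. 0"]) simp_all
    qed auto
  qed (simp add: algebra_simps)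
qed

text \<open>The output overwrites the start of the matrix, so \<open>base\<close> is given up in the
  invariant. The best cut, from n * n + 2 * n on, lies beyond the cells being written.\<close>

lemma runs_output_com:
  assumes "base s" "arr 2 x s" "\<And>v. x v \<le> 1"
  shows "runs output_com s (4 * unit_cost * (n + 1)) (\<lambda>s'. \<forall>v<n. snd s' v = x v)"
proof -
  let ?P = "\<lambda>i s'. i \<le> n \<and> fst s' 7 = i \<and> fst s' 0 = n \<and> bounded_state (2 * n + 4) s' \<and> arr 2 x s' \<and>
    (\<forall>v<i. snd s' v = x v)"
  show ?thesis unfolding output_com_def
  proof (rule runs_weaken[OF runs_For[where P = ?P and N = n]])
    show "fst t 7 = i \<and> val t (Reg 0) = n \<and> bounded_state (2 * n + 4) t" if "?P i t" for i t
      using that by simp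
    show "bounded_state (2 * n + 4) s" using assms(1) by (simp add: base_def)
    show "?P 0 ((fst s)(7 := 0), snd s)"
      using assms bounded_state_reg[of s 0 7] by (simp add: base_def arr_def)
    fix i t assume i: "i < n" and P: "?P i t"
    have x: "snd t (n * n + 2 * n + i) = x i" using P i by (simp add: arr_def)
    have "x i < 2 ^ (2 * n + 4)" using assms(3)[of i] by (intro small) simp
    then have b: "bounded_state (2 * n + 4) (fst t, (snd t)(i := x i))"
      using P by (simp add: bounded_state_mem)
    have b': "bounded_state (2 * n + 4) ((fst t)(7 := Suc i), (snd t)(i := x i))"
      using bounded_state_reg[OF b, of "Suc i" 7] vertex_small[of "Suc i"] i by simp
    show "runs (Store (Reg 7) (Load (cell 2 7))) t unit_cost (\<lambda>s'. fst s' 7 = i \<and>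
      bounded_state (2 * n + 4) s' \<and> ?P (Suc i) ((fst s')(7 := Suc i), snd s'))"
      by (rule runs_Store) (use P i x b b' in \<open>auto simp: less_Suc_eq arr_def\<close>)
  qed (auto simp: algebra_simps)
qed

lemma runs_program:
  assumes "fst s = (\<lambda>_. 0)(0 := n)" "\<And>u v. u < n \<Longrightarrow> v < n \<Longrightarrow> snd s (u * n + v) = a u v"
    "\<And>i. i \<ge> n * n \<Longrightarrow> snd s i = 0" "\<And>i. snd s i \<le> 1" and split: "split_part K"
  shows "runs program s (730 * 20004 * 2 ^ (n div 2) * (n + 1) ^ 9)
    (\<lambda>s'. \<exists>x. (\<forall>v. x v \<le> 1) \<and> (\<forall>v<n. snd s' v = x v) \<and>
      (\<forall>y. (\<forall>v. y v \<le> 1) \<longrightarrow> cut_value y \<le> cut_value x))"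
    (is "runs _ _ _ ?Q")
proof -
  let ?A = "6 * unit_cost * (n + 1)" and ?B = "720 * M * unit_cost * (n + 1) ^ 8"
    and ?C = "4 * unit_cost * (n + 1)"
  have "runs program s (?A + (?B + ?C)) ?Q"
    unfolding program_def
  proof (rule runs_Seq[OF runs_init_com[OF assms(1-4)]])
    fix s1 assume "invar s1"
    then show "runs (Seq search_com output_com) s1 (?B + ?C) ?Q"
    proof (rule runs_Seq[OF runs_search_com])
      fix s2 assume s2: "invar s2 \<and> (\<forall>m<M. \<forall>p\<le>2 * n * n + n. \<forall>q\<le>2 * n * n + n. \<forall>\<theta>\<le>2 * n * n + n.
        cut_value (candidate m p q \<theta>) \<le> fst s2 6)"
      then obtain x where x: "\<And>v. x v \<le> 1" "arr 2 x s2" "fst s2 6 = cut_value x" "base s2"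
        by (auto simp: invar_def)
      have opt: "cut_value y \<le> cut_value x" if "\<forall>v. y v \<le> 1" for y
      proof -
        have y: "\<And>v. y v \<le> 1" using that by blast
        obtain m p q \<theta> where *: "m < M" "p \<le> 2 * n * n + n" "q \<le> 2 * n * n + n" "\<theta> \<le> 2 * n * n + n"
          "cut_value y \<le> cut_value (candidate m p q \<theta>)"
          using candidate_optimal[of K y, OF split y] unfolding M_def by blast
        then have "cut_value (candidate m p q \<theta>) \<le> fst s2 6" using s2 by blast
        with *(5) x(3) show ?thesis by simp
      qed
      show "runs output_com s2 ?C ?Q"
        by (rule runs_weaken[OF runs_output_com[OF x(4,2,1)]]) (use x(1) opt in auto)
    qed (rule order_refl)
  qed simp_all
  moreover have "?A + (?B + ?C) \<le> 730 * 20004 * 2 ^ (n div 2) * (n + 1) ^ 9"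
  proof -
    define k where "k = n + 1"
    \<comment> \<open>This absorbs the linear cost of initialisation and output, 6 + 4 = 10, into
      the search term; 730 is 10 + 720.\<close>
    have k: "k \<le> M * k ^ 8"
      using mult_le_mono[of 1 M k "k ^ 8"] self_le_power[of k 8] by (simp add: M_def k_def)
    \<comment> \<open>5001 * (2 * n + 4) is at most 5001 * 4 * (n + 1).\<close>
    have U: "unit_cost \<le> 20004 * k" by (simp add: unit_cost_def k_def)
    have "?A + (?B + ?C) = unit_cost * (10 * k + 720 * (M * k ^ 8))"
      unfolding k_def[symmetric] by (simp add: algebra_simps)
    also have "\<dots> \<le> (20004 * k) * (10 * (M * k ^ 8) + 720 * (M * k ^ 8))"
      by (rule mult_le_mono[OF U add_le_mono[OF mult_le_mono2[OF k] order_refl]])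
    also have "\<dots> = 730 * 20004 * M * (k * k ^ 8)" by (simp add: mult_ac)
    also have "k * k ^ 8 = k ^ 9" using power_Suc[of k 8] by simp
    finally show ?thesis by (simp add: M_def k_def)
  qed
  ultimately show ?thesis by (rule runs_weaken)
qed

end

section \<open>From edge sets to adjacency matrices, and the asymptotic bound\<close>

definition adjacent :: "nat set set \<Rightarrow> nat \<Rightarrow> nat \<Rightarrow> nat" where
  "adjacent E u v = (if {u, v} \<in> E then 1 else 0)"

lemma adjacency_adjacent:
  assumes "simple_graph {..<n} E"
  shows "adjacency n (adjacent E)"
proof
  show "adjacent E v v = 0" for v
  proof -
    have "card {v, v} \<noteq> 2" by simp
    then show ?thesis using assms unfolding simple_graph_def adjacent_def by metis
  qed
qed (simp_all add: adjacent_def insert_commute)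

text \<open>As the sides are disjoint, a cut edge comes from exactly one ordered pair with its first
  vertex on the first side.\<close>

lemma cut_size_eq_cut_value:
  assumes "simple_graph {..<n} E" "\<And>v. x v \<le> 1"
  shows "cut_size E {v. v < n \<and> x v \<noteq> 0} ({..<n} - {v. v < n \<and> x v \<noteq> 0}) =
    adjacency.cut_value n (adjacent E) x"
proof -
  interpret adjacency n "adjacent E" by (rule adjacency_adjacent[OF assms(1)])
  let ?A = "{v. v < n \<and> x v \<noteq> 0}"
  let ?B = "{..<n} - ?A"
  let ?P = "{(u, v). u \<in> ?A \<and> v \<in> ?B \<and> {u, v} \<in> E}"
  have "{e \<in> E. \<exists>u\<in>?A. \<exists>v\<in>?B. e = {u, v}} = (\<lambda>(u, v). {u, v}) ` ?P"
  proof -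
    have "{e \<in> E. \<exists>u\<in>A. \<exists>v\<in>B. e = {u, v}} =
      (\<lambda>(u, v). {u, v}) ` {(u, v). u \<in> A \<and> v \<in> B \<and> {u, v} \<in> E}" for A B by auto
    then show ?thesis .
  qed
  moreover have "inj_on (\<lambda>(u, v). {u, v}) ?P"
    by (auto simp: inj_on_def doubleton_eq_iff)
  ultimately have "cut_size E ?A ?B = card ?P" unfolding cut_size_def by (simp add: card_image)
  also have "\<dots> = (\<Sum>(u, v)\<in>{..<n} \<times> {..<n}. if (u, v) \<in> ?P then 1 else 0)"
  proof -
    have "?P = {..<n} \<times> {..<n} \<inter> {z. z \<in> ?P}" by auto
    then have "card ?P = card ({..<n} \<times> {..<n} \<inter> {z. z \<in> ?P})" by (rule arg_cong)
    then show ?thesis by (simp add: sum.If_cases split_def)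
  qed
  also have "\<dots> = (\<Sum>u<n. \<Sum>v<n. if (u, v) \<in> ?P then 1 else 0)"
    by (rule sum.cartesian_product[symmetric])
  also have "\<dots> = (\<Sum>u<n. \<Sum>v<n. x u * (adjacent E u v * (1 - x v)))"
  proof (intro sum.cong refl)
    fix u v assume "u \<in> {..<n}" "v \<in> {..<n}"
    moreover have "x u = 0 \<or> x u = 1" "x v = 0 \<or> x v = 1" using assms(2)[of u] assms(2)[of v] by auto
    ultimately show "(if (u, v) \<in> ?P then 1 else 0) = x u * (adjacent E u v * (1 - x v))"
      by (auto simp: adjacent_def)
  qed
  finally show ?thesis by (simp add: cut_value_def sum_distrib_left)
qed

lemma solves_maxcut_program:
  "solves_maxcut_on split_graph program (\<lambda>n. 730 * 20004 * 2 ^ (n div 2) * (n + 1) ^ 9)"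
  unfolding solves_maxcut_on_def
proof (intro allI impI)
  fix n :: nat and E :: "nat set set"
  assume "split_graph {..<n} E"
  then obtain K I where simple: "simple_graph {..<n} E" and KI: "K \<union> I = {..<n}" "K \<inter> I = {}"
    "clique E K" "independent_set E I" by (auto simp: split_graph_def)
  interpret adjacency n "adjacent E" by (rule adjacency_adjacent[OF simple])
  have I: "{..<n} - K = I" using KI(1,2) by blast
  \<comment> \<open>The given partition serves only to show that good thresholds exist; the program
    never sees it.\<close>
  have split: "split_part K"
    unfolding split_part_def I using KI by (auto simp: clique_def independent_set_def adjacent_def)
  let ?s = "encode_graph n E"
  have "snd ?s (u * n + v) = adjacent E u v" if "u < n" "v < n" for u v
    using that index_less[OF that] by (simp add: encode_graph_def adjacent_def)
  then have "runs program ?s (730 * 20004 * 2 ^ (n div 2) * (n + 1) ^ 9)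
    (\<lambda>s'. \<exists>x. (\<forall>v. x v \<le> 1) \<and> (\<forall>v<n. snd s' v = x v) \<and>
      (\<forall>y. (\<forall>v. y v \<le> 1) \<longrightarrow> cut_value y \<le> cut_value x))"
    by (intro runs_program[OF _ _ _ _ split]) (simp_all add: encode_graph_def)
  then obtain t s' x where run: "exec program ?s t s'" "t \<le> 730 * 20004 * 2 ^ (n div 2) * (n + 1) ^ 9"
    and x: "\<And>v. x v \<le> 1" "\<And>v. v < n \<Longrightarrow> snd s' v = x v"
    and opt: "\<And>y. (\<And>v. y v \<le> 1) \<Longrightarrow> cut_value y \<le> cut_value x"
    unfolding runs_def by metis
  have dec: "decode_cut n s' = {v. v < n \<and> x v \<noteq> 0}" using x(2) by (auto simp: decode_cut_def)
  have "is_max_cut {..<n} E (decode_cut n s') ({..<n} - decode_cut n s')"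
    unfolding is_max_cut_def
  proof (intro conjI allI impI)
    show "is_cut {..<n} (decode_cut n s') ({..<n} - decode_cut n s')"
      by (auto simp: is_cut_def decode_cut_def)
    fix W1 W2 assume W: "is_cut {..<n} W1 W2"
    define y where "y v = (if v \<in> W1 then 1 else 0 :: nat)" for v
    have W1: "W1 = {v. v < n \<and> y v \<noteq> 0}" and W2: "W2 = {..<n} - W1"
      using W by (auto simp: is_cut_def y_def)
    have y: "y v \<le> 1" for v by (simp add: y_def)
    have "cut_size E W1 W2 = cut_value y"
      unfolding W2 W1 by (rule cut_size_eq_cut_value[OF simple y])
    also have "\<dots> \<le> cut_value x" by (rule opt[OF y])
    also have "\<dots> = cut_size E (decode_cut n s') ({..<n} - decode_cut n s')"
      unfolding dec by (rule cut_size_eq_cut_value[OF simple x(1), symmetric])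
    finally show "cut_size E W1 W2 \<le> cut_size E (decode_cut n s') ({..<n} - decode_cut n s')" .
  qed
  with run show "\<exists>t s. exec program ?s t s \<and> t \<le> 730 * 20004 * 2 ^ (n div 2) * (n + 1) ^ 9 \<and>
    is_max_cut {..<n} E (decode_cut n s) ({..<n} - decode_cut n s)" by blast
qed

lemma two_powr_half_le: "2 powr (real n / 2) \<le> 1.42 ^ n"
proof -
  have "2 powr (real n / 2) = (2 powr (1 / 2)) powr real n" by (simp add: powr_powr)
  also have "\<dots> = sqrt 2 ^ n" by (simp add: powr_realpow powr_half_sqrt)
  \<comment> \<open>1.42 * 1.42 = 2.0164.\<close>
  also have "\<dots> \<le> 1.42 ^ n"
    by (intro power_mono real_le_lsqrt) (simp_all add: power2_eq_square)
  finally show ?thesis .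
qed

theorem theorem1:
  "(\<exists>c T. solves_maxcut_on split_graph c T \<and>
      (\<lambda>n. real (T n)) \<in> O_star (\<lambda>n. 2 powr (real n / 2))) \<and>
   O_star (\<lambda>n. 2 powr (real n / 2)) \<subseteq> O_star (\<lambda>n. 1.42 ^ n)"
proof (intro conjI exI)
  show "solves_maxcut_on split_graph program (\<lambda>n. 730 * 20004 * 2 ^ (n div 2) * (n + 1) ^ 9)"
    by (rule solves_maxcut_program)
  let ?T = "\<lambda>n :: nat. 730 * 20004 * 2 ^ (n div 2) * (n + 1) ^ 9 :: nat"
  \<comment> \<open>\<open>[:1, 1:] ^ 9\<close> is the polynomial (x + 1)^9.\<close>
  have "(\<lambda>n. real (?T n)) \<in> O(\<lambda>n. 2 powr (real n / 2) * poly ([:1, 1:] ^ 9) (real n))"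
  proof (rule bigoI[of _ "730 * 20004"], intro always_eventually allI)
    fix n :: nat
    have "2 ^ (n div 2) = (2::real) powr real (n div 2)" by (simp add: powr_realpow)
    also have "\<dots> \<le> 2 powr (real n / 2)" by (intro powr_mono) linarith+
    finally have "2 ^ (n div 2) * real (n + 1) ^ 9 \<le> 2 powr (real n / 2) * real (n + 1) ^ 9"
      by (intro mult_right_mono) auto
    then show "norm (real (?T n)) \<le> 730 * 20004 * norm (2 powr (real n / 2) * poly ([:1, 1:] ^ 9) (real n))"
      by (simp add: poly_power abs_mult add.commute)
  qed
  then show "(\<lambda>n. real (?T n)) \<in> O_star (\<lambda>n. 2 powr (real n / 2))"
    unfolding O_star_def by blast
  have "(\<lambda>n. 2 powr (real n / 2) * poly p (real n)) \<in> O(\<lambda>n. 1.42 ^ n * poly p (real n))" for p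
    by (intro landau_o.big.mult bigoI[of _ 1] always_eventually allI)
      (use two_powr_half_le in auto)
  then show "O_star (\<lambda>n. 2 powr (real n / 2)) \<subseteq> O_star (\<lambda>n. 1.42 ^ n)"
    unfolding O_star_def by (blast intro: landau_o.big_trans)
qed

end
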